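(* Let $q,p\ge 1$, let $d_h,\rho_h>0$ ($1\le h\le q$) and let $\xi_1,\dots,\xi_p\in\mathbb R$ satisfy $\xi_i+\rho_h>0$ for all $i,h$. Put $D=\sum_{h=1}^q d_h$. For $\tau>0$ put $$a_h(\tau)=\tau\rho_h-1,\qquad b_h(\tau)=\tau\rho_h+d_h-1,\qquad \alpha_i(\tau)=\tau\xi_i,$$ and let $w_{0,\tau}^{\mathrm J},w_{1,\tau}^{\mathrm J},\dots,w_{q,\tau}^{\mathrm J}$ be the Jacobi weights (see context) with parameters $\boldsymbol a(\tau),\boldsymbol b(\tau)$. Then, with the reflected densities extended by zero outside $0<y<\tau$, $$\tau^{D-1}w_{0,\tau}^{\mathrm J}\Bigl(1-\frac y\tau\Bigr)\xrightarrow[\tau\to+\infty]{}F_0(y),\qquad \tau^{D}w_{j,\tau}^{\mathrm J}\Bigl(1-\frac y\tau\Bigr)\xrightarrow[\tau\to+\infty]{}F_j(y)\quad(1\le j\le q),$$ locally uniformly on $(0,\infty)$. The corresponding finite measures (these densities times $\mathrm dy$) converge weakly, and every fixed polynomial moment converges. For the complete mixed-type matrix, for $1\le j\le q$ and $1\le i\le p$, $$\tau^{D}\Bigl(1-\frac y\tau\Bigr)^{\alpha_i(\tau)}w_{j,\tau}^{\mathrm J}\Bigl(1-\frac y\tau\Bigr)\xrightarrow[\tau\to+\infty]{}\mathrm e^{-\xi_iy}F_j(y)$$ locally uniformly on $(0,\infty)$. Moreover, for every $n\in\mathbb N_0$, $$\int_0^\tau y^n\tau^D\Bigl(1-\frac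 y\tau\Bigr)^{\alpha_i(\tau)}w_{j,\tau}^{\mathrm J}\Bigl(1-\frac y\tau\Bigr)\,\mathrm dy\xrightarrow[\tau\to+\infty]{}\int_0^\infty y^n\mathrm e^{-\xi_iy}F_j(y)\,\mathrm dy .$$ (Equivalently, after the change of variables $x=1-y/\tau$ the original matrix measure $[w_{j,\tau}^{\mathrm J}(x)x^{\alpha_i(\tau)}]_{j,i}\,\mathrm dx$ is multiplied by $\tau^{D+1}$, one power of $\tau$ being the Jacobian.)
   Context: Beta weights: for $-1<a<b$, $\mathcal B_{a,b}(x)=\frac{x^a(1-x)^{b-a-1}}{\Gamma(b-a)}\mathbf 1_{(0,1)}(x)$. Mellin convolution: $(f*g)(x)=\int_0^\infty f(t)g(x/t)\,\frac{\mathrm dt}{t}$. Jacobi weights with parameters $\boldsymbol a=(a_1,\dots,a_q)$, $\boldsymbol b=(b_1,\dots,b_q)$, $-1<a_h<b_h$: $w_0^{\mathrm J}=\mathcal B_{a_1,b_1}*\cdots*\mathcal B_{a_q,b_q}$, and for $1\le j\le q$, $w_j^{\mathrm J}$ is the same Mellin convolution with $b_j$ replaced by $b_j+1$. Gamma kernels: $g_{\rho,d}(y)=\frac{y^{d-1}\mathrm e^{-\rho y}}{\Gamma(d)}\mathbf 1_{(0,\infty)}(y)$, $\rho,d>0$. Additive convolution on $(0,\infty)$: $(f*_+g)(y)=\int_0^yf(u)g(y-u)\,\mathrm du$. The limiting rows are $F_0=g_{\rho_1,d_1}*_+\cdots*_+g_{\rho_q,d_q}$ and, for $1\le j\le q$,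 $F_j$ is the same convolution with $d_j$ replaced by $d_j+1$. Weak convergence of finite positive measures means convergence of integrals against bounded continuous functions. *)

theory Defs
  imports "HOL-Analysis.Analysis"
begin

definition beta_weight :: "real \<Rightarrow> real \<Rightarrow> real \<Rightarrow> real" where
  "beta_weight a b x =
     (if 0 < x \<and> x < 1 then x powr a * (1 - x) powr (b - a - 1) / Gamma (b - a) else 0)"

definition gamma_kernel :: "real \<Rightarrow> real \<Rightarrow> real \<Rightarrow> real" where
  "gamma_kernel \<rho> d y = (if 0 < y then y powr (d - 1) * exp (- \<rho> * y) / Gamma d else 0)"

definition mellin_conv :: "(real \<Rightarrow> real) \<Rightarrow> (real \<Rightarrow> real) \<Rightarrow> real \<Rightarrow> real" where
  "mellin_conv f g x = (LBINT t:{0<..}. f t * g (x / t) / t)"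

definition add_conv :: "(real \<Rightarrow> real) \<Rightarrow> (real \<Rightarrow> real) \<Rightarrow> real \<Rightarrow> real" where
  "add_conv f g y = (LBINT u:{0..y}. f u * g (y - u))"

text \<open>The convolution of \<open>f 1, \<dots>, f q\<close> for \<open>q \<ge> 1\<close>, bracketed to the left; the factors are
  indexed from 1, so \<open>f 0\<close> plays no role.\<close>

definition iterated_conv ::
    "((real \<Rightarrow> real) \<Rightarrow> (real \<Rightarrow> real) \<Rightarrow> real \<Rightarrow> real) \<Rightarrow> nat \<Rightarrow> (nat \<Rightarrow> real \<Rightarrow> real) \<Rightarrow> real \<Rightarrow> real" where
  "iterated_conv cnv q f = foldl cnv (f 1) (map f [2..<Suc q])"

definition jacobi_weight :: "nat \<Rightarrow> (nat \<Rightarrow> real) \<Rightarrow> (nat \<Rightarrow> real) \<Rightarrow> nat \<Rightarrow> real \<Rightarrow> real" where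
  "jacobi_weight q a b j =
     (let b' = (if j = 0 then b else b(j := b j + 1))
      in iterated_conv mellin_conv q (\<lambda>h. beta_weight (a h) (b' h)))"

definition gamma_row :: "nat \<Rightarrow> (nat \<Rightarrow> real) \<Rightarrow> (nat \<Rightarrow> real) \<Rightarrow> nat \<Rightarrow> real \<Rightarrow> real" where
  "gamma_row q \<rho> d j =
     (let d' = (if j = 0 then d else d(j := d j + 1))
      in iterated_conv add_conv q (\<lambda>h. gamma_kernel (\<rho> h) (d' h)))"

definition reflected :: "real \<Rightarrow> (real \<Rightarrow> real) \<Rightarrow> real \<Rightarrow> real" where
  "reflected \<tau> w y = (if 0 < y \<and> y < \<tau> then w (1 - y / \<tau>) else 0)"

definition locally_uniform_limit ::
    "real set \<Rightarrow> ('i \<Rightarrow> real \<Rightarrow> real) \<Rightarrow> (real \<Rightarrow> real) \<Rightarrow> 'i filter \<Rightarrow> bool" where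
  "locally_uniform_limit S f l F \<longleftrightarrow>
     (\<forall>x\<in>S. \<exists>\<epsilon>>0. uniform_limit (S \<inter> ball x \<epsilon>) f l F)"

text \<open>The measure \<open>f(x) dx\<close> on the Borel subsets of \<open>S\<close>. It is only applied to nonnegative \<open>f\<close>,
  so the truncation of negative values by \<open>ennreal\<close> plays no role.\<close>

definition density_on :: "real set \<Rightarrow> (real \<Rightarrow> real) \<Rightarrow> real measure" where
  "density_on S f = density (restrict_space lborel S) (\<lambda>x. ennreal (f x))"

text \<open>Weak convergence of finite Borel measures on the subspace \<open>S\<close> of the real line. The test
  functions are the bounded continuous functions on \<open>S\<close>; they need not extend continuously to
  the closure of \<open>S\<close>.\<close>

definition weakly_converges_on ::
    "real set \<Rightarrow> ('i \<Rightarrow> real measure) \<Rightarrow> real measure \<Rightarrow> 'i filter \<Rightarrow> bool" where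
  "weakly_converges_on S M N F \<longleftrightarrow>
     (\<forall>\<phi>::real \<Rightarrow> real. continuous_on S \<phi> \<and> bounded (\<phi> ` S) \<longrightarrow>
        ((\<lambda>i. \<integral>x. \<phi> x \<partial>M i) \<longlongrightarrow> (\<integral>x. \<phi> x \<partial>N)) F)"

end

theory Submission
  imports Defs
begin

text \<open>
  Under \<open>x = e\<^sup>-\<^sup>s\<close> the Mellin convolution becomes the additive one, and the beta weight becomes
  \<open>e\<^sup>-\<^sup>(\<^sup>\<tau>\<^sup>\<rho>\<^sup>-\<^sup>1\<^sup>)\<^sup>s (1 - e\<^sup>-\<^sup>s)\<^sup>d\<^sup>-\<^sup>1 / \<Gamma>(d)\<close>. Since \<open>s e\<^sup>-\<^sup>s \<le> 1 - e\<^sup>-\<^sup>s \<le> s\<close>, this lies between two gamma kernels whose rates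
  differ from \<open>\<tau> \<rho>\<close> by a constant. Convolution is monotone and commutes with exponential tilting and
  dilation, so the rescaled weight at \<open>y\<close> is squeezed between two explicit multiples of \<open>F(y)\<close>, both
  tending to 1 locally uniformly; the upper factor is \<open>exp(O(y / \<tau>))\<close> on the whole of \<open>(0, \<tau>)\<close>. With
  \<open>F(y) \<le> C y\<^sup>D\<^sup>-\<^sup>1 e\<^sup>-\<^sup>r\<^sup>y\<close>, dominated convergence gives the weak convergence and the moments.
  Raising \<open>d j\<close> by one turns row \<open>j\<close> into row \<open>0\<close>, and the factor \<open>x\<^sup>\<tau>\<^sup>\<xi>\<close> replaces every \<open>\<rho> h\<close> by \<open>\<rho> h + \<xi>\<close>.
\<close>

section \<open>Iterated convolutions\<close>

lemma iterated_conv_1 [simp]: "iterated_conv cnv (Suc 0) f = f (Suc 0)"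
  by (simp add: iterated_conv_def)

lemma iterated_conv_Suc:
  "1 \<le> q \<Longrightarrow> iterated_conv cnv (Suc q) f = cnv (iterated_conv cnv q f) (f (Suc q))"
  by (simp add: iterated_conv_def)

lemma borel_measurable_add_conv [measurable]:
  assumes [measurable]: "f \<in> borel_measurable borel" "g \<in> borel_measurable borel"
  shows "add_conv f g \<in> borel_measurable borel"
proof -
  have "(\<lambda>(y, u). indicator {0..y} u *\<^sub>R (f u * g (y - u)))
      = (\<lambda>(y::real, u::real). if 0 \<le> u \<and> u \<le> y then f u * g (y - u) else 0)"
    by (auto simp: indicator_def fun_eq_iff)
  also have "\<dots> \<in> borel_measurable (borel \<Otimes>\<^sub>M lborel)" by measurable
  finally have "(\<lambda>y. \<integral>u. indicator {0..y} u *\<^sub>R (f u * g (y - u)) \<partial>lborel) \<in> borel_measurable borel"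
    by (rule lborel.borel_measurable_lebesgue_integral)
  then show ?thesis
    by (simp add: add_conv_def[abs_def] set_lebesgue_integral_def)
qed

lemma borel_measurable_mellin_conv [measurable]:
  assumes [measurable]: "f \<in> borel_measurable borel" "g \<in> borel_measurable borel"
  shows "mellin_conv f g \<in> borel_measurable borel"
  unfolding mellin_conv_def[abs_def] set_lebesgue_integral_def
  by (rule lborel.borel_measurable_lebesgue_integral) measurable

lemma borel_measurable_iterated_conv:
  assumes "1 \<le> q" and "\<And>h. h \<in> {1..q} \<Longrightarrow> f h \<in> borel_measurable borel"
    and "\<And>f g. f \<in> borel_measurable borel \<Longrightarrow> g \<in> borel_measurable borel \<Longrightarrow> cnv f g \<in> borel_measurable borel"
  shows "iterated_conv cnv q f \<in> borel_measurable borel"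
  using assms(1,2)
  by (induction q rule: nat_induct_at_least) (auto simp: iterated_conv_Suc intro!: assms(3))

section \<open>Additive convolution of functions with gamma-type bounds\<close>

lemma
  fixes a b y :: real
  assumes "0 < a" "0 < b" "0 < y"
  shows set_integrable_Beta_scaled:
      "set_integrable lborel {0..y} (\<lambda>u. u powr (a - 1) * (y - u) powr (b - 1))"
    and LBINT_Beta_scaled:
      "(LBINT u:{0..y}. u powr (a - 1) * (y - u) powr (b - 1)) = Beta a b * y powr (a + b - 1)"
proof -
  let ?f = "\<lambda>t::real. indicator {0..1} t *\<^sub>R (t powr (a - 1) * (1 - t) powr (b - 1))"
  have int: "set_integrable lborel {0..1} (\<lambda>t. t powr (a - 1) * (1 - t) powr (b - 1))"
    using assms by (intro integrable_Beta)
  have "(LBINT t:{0..1}. t powr (a - 1) * (1 - t) powr (b - 1)) = Beta a b"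
    using set_borel_integral_eq_integral(2)[OF int] has_integral_Beta_real[OF assms(1,2)]
    by (simp add: integral_unique)
  with int have "has_bochner_integral lborel ?f (Beta a b)"
    by (simp add: has_bochner_integral_iff set_integrable_def set_lebesgue_integral_def)
  then have "has_bochner_integral lborel (\<lambda>u. ?f (0 + (1/y) * u)) (Beta a b /\<^sub>R \<bar>1/y\<bar>)"
    using assms(3) by (subst lborel_has_bochner_integral_real_affine_iff[symmetric]) auto
  \<comment> \<open>The factor \<open>y powr (a + b - 2)\<close> clears the denominators of the
    powers of \<open>u / y\<close> and \<open>1 - u / y\<close>; the Jacobian then contributes one
    more power of \<open>y\<close>.\<close>
  then have 1: "has_bochner_integral lborel (\<lambda>u. y powr (a + b - 2) * ?f (0 + (1/y) * u))
     (y powr (a + b - 2) * (Beta a b /\<^sub>R \<bar>1/y\<bar>))"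
    by (rule has_bochner_integral_mult_right)
  have 2: "y powr (a + b - 2) * ?f (0 + (1/y) * u)
      = indicator {0..y} u *\<^sub>R (u powr (a - 1) * (y - u) powr (b - 1))" for u
  proof (cases "0 \<le> u \<and> u \<le> y")
    case True
    have *: "1 - u / y = (y - u) / y" using assms(3) by (simp add: field_simps)
    have "y powr (a + b - 2) = y powr (a - 1) * y powr (b - 1)"
      using assms(3) by (simp add: powr_add[symmetric])
    then show ?thesis using True assms(3)
      by (simp add: * powr_divide)
  next
    case False
    then show ?thesis using assms(3) by (auto simp: indicator_def field_simps)
  qed
  have 3: "y powr (a + b - 2) * (Beta a b /\<^sub>R \<bar>1/y\<bar>) = Beta a b * y powr (a + b - 1)"
  proof -
    have "y powr (a + b - 1) = y powr (a + b - 2) * y powr 1"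
      by (subst powr_add[symmetric]) simp
    then show ?thesis using assms(3) by simp
  qed
  have "has_bochner_integral lborel (\<lambda>u. indicator {0..y} u *\<^sub>R (u powr (a - 1) * (y - u) powr (b - 1)))
     (Beta a b * y powr (a + b - 1))"
    using 1 unfolding 2 3 .
  then show "set_integrable lborel {0..y} (\<lambda>u. u powr (a - 1) * (y - u) powr (b - 1))"
    "(LBINT u:{0..y}. u powr (a - 1) * (y - u) powr (b - 1)) = Beta a b * y powr (a + b - 1)"
    by (simp_all add: has_bochner_integral_iff set_integrable_def set_lebesgue_integral_def)
qed

text \<open>A class closed under \<open>add_conv\<close>: for a common rate \<open>A\<close> the
  exponents \<open>\<delta>\<close> add up, as they do for gamma kernels. It supplies the
  integrability without which Bochner integrals cannot be compared. \<open>A\<close> may have either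
  sign; decay corresponds to \<open>A < 0\<close>.\<close>

definition gamma_dominated :: "real \<Rightarrow> real \<Rightarrow> (real \<Rightarrow> real) \<Rightarrow> bool" where
  "gamma_dominated A \<delta> f \<longleftrightarrow> f \<in> borel_measurable borel \<and> (\<forall>y. 0 \<le> f y) \<and> (\<forall>y\<le>0. f y = 0) \<and>
     (\<exists>C\<ge>0. \<forall>y>0. f y \<le> C * (y powr (\<delta> - 1) * exp (A * y)))"

lemma gamma_dominatedD:
  assumes "gamma_dominated A \<delta> f"
  shows "f \<in> borel_measurable borel" "0 \<le> f y" "y \<le> 0 \<Longrightarrow> f y = 0"
  using assms by (auto simp: gamma_dominated_def)

lemma gamma_dominated_le:
  assumes "gamma_dominated A \<delta> g" "f \<in> borel_measurable borel" "\<And>y. 0 \<le> f y" "\<And>y. f y \<le> g y"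
  shows "gamma_dominated A \<delta> f"
proof -
  obtain C where C: "C \<ge> 0" "\<forall>y>0. g y \<le> C * (y powr (\<delta> - 1) * exp (A * y))"
    using assms(1) by (auto simp: gamma_dominated_def)
  have "f y = 0" if "y \<le> 0" for y
    using assms(3)[of y] assms(4)[of y] gamma_dominatedD(3)[OF assms(1) that] by linarith
  then show ?thesis
    unfolding gamma_dominated_def using C assms(2,3,4) by (meson order_trans)
qed

text \<open>As the arguments add up to \<open>y\<close>, the exponentials combine to
  \<open>exp (A * y)\<close> and the powers leave a Beta integral; hence the bound keeps its shape,
  with exponent \<open>a + b\<close>.\<close>

lemma
  assumes f: "gamma_dominated A a f" and g: "gamma_dominated A b g" and pos: "0 < a" "0 < b"
  shows set_integrable_add_conv: "set_integrable lborel {0..y} (\<lambda>u. f u * g (y - u))"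
    and gamma_dominated_add_conv: "gamma_dominated A (a + b) (add_conv f g)"
proof -
  note [measurable] = gamma_dominatedD(1)[OF f] gamma_dominatedD(1)[OF g]
  obtain C1 where C1: "C1 \<ge> 0" "\<forall>y>0. f y \<le> C1 * (y powr (a - 1) * exp (A * y))"
    using f by (auto simp: gamma_dominated_def)
  obtain C2 where C2: "C2 \<ge> 0" "\<forall>y>0. g y \<le> C2 * (y powr (b - 1) * exp (A * y))"
    using g by (auto simp: gamma_dominated_def)
  let ?h = "\<lambda>y u. C1 * C2 * exp (A * y) * (u powr (a - 1) * (y - u) powr (b - 1))"
  have bound: "f u * g (y - u) \<le> ?h y u" if "u \<in> {0..y}" for u y
  proof (cases "0 < u \<and> u < y")
    case True
    have "f u * g (y - u) \<le> (C1 * (u powr (a - 1) * exp (A * u))) * (C2 * ((y - u) powr (b - 1) * exp (A * (y - u))))"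
      using True C1 C2 gamma_dominatedD(2)[OF f] gamma_dominatedD(2)[OF g] by (intro mult_mono) auto
    also have "exp (A * y) = exp (A * u) * exp (A * (y - u))"
      by (simp add: exp_add[symmetric] algebra_simps)
    then have "(C1 * (u powr (a - 1) * exp (A * u))) * (C2 * ((y - u) powr (b - 1) * exp (A * (y - u)))) = ?h y u"
      by simp
    finally show ?thesis .
  next
    \<comment> \<open>Only \<open>u = 0\<close> and \<open>u = y\<close> remain, and there one
      factor on the left is zero.\<close>
    case False
    then have "f u = 0 \<or> g (y - u) = 0"
      using that gamma_dominatedD(3)[OF f, of u] gamma_dominatedD(3)[OF g, of "y - u"] by auto
    then show ?thesis using C1 C2 by auto
  qed
  have hint: "set_integrable lborel {0..y} (?h y)" if "y > 0" for y
    using set_integrable_Beta_scaled[OF pos that] by (intro set_integrable_mult_right) auto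
  have int: "set_integrable lborel {0..y} (\<lambda>u. f u * g (y - u))" if "y > 0" for y
  proof (rule set_integrable_bound[OF hint[OF that]])
    show "set_borel_measurable lborel {0..y} (\<lambda>u. f u * g (y - u))"
      unfolding set_borel_measurable_def by measurable
    have "norm (f u * g (y - u)) \<le> norm (?h y u)" if "u \<in> {0..y}" for u
      using bound[OF that] gamma_dominatedD(2)[OF f, of u] gamma_dominatedD(2)[OF g, of "y - u"]
        mult_nonneg_nonneg[of "f u" "g (y - u)"]
      unfolding real_norm_def by linarith
    then show "AE u in lborel. u \<in> {0..y} \<longrightarrow> norm (f u * g (y - u)) \<le> norm (?h y u)"
      by auto
  qed
  \<comment> \<open>For \<open>y \<le> 0\<close> the interval is empty or the single point 0, where
    \<open>f\<close> vanishes.\<close>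
  have zero: "indicator {0..y} u * (f u * g (y - u)) = 0" if "y \<le> 0" for y u
    using that gamma_dominatedD(3)[OF f, of u] by (auto simp: indicator_def)
  show "set_integrable lborel {0..y} (\<lambda>u. f u * g (y - u))"
    using int[of y] by (cases "y > 0") (simp_all add: set_integrable_def zero del: mult_eq_0_iff)
  have "add_conv f g y \<le> C1 * C2 * Beta a b * (y powr (a + b - 1) * exp (A * y))" if "y > 0" for y
  proof -
    have "add_conv f g y \<le> (LBINT u:{0..y}. ?h y u)"
      unfolding add_conv_def using int[OF that] hint[OF that] bound by (intro set_integral_mono) auto
    also have "\<dots> = C1 * C2 * exp (A * y) * (Beta a b * y powr (a + b - 1))"
      by (simp only: set_integral_mult_right LBINT_Beta_scaled[OF pos that])
    finally show ?thesis by (simp add: mult_ac)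
  qed
  moreover have "0 \<le> add_conv f g y" for y
    unfolding add_conv_def set_lebesgue_integral_def
    using gamma_dominatedD(2)[OF f] gamma_dominatedD(2)[OF g] by (intro integral_nonneg_AE) auto
  moreover have "add_conv f g y = 0" if "y \<le> 0" for y
    unfolding add_conv_def set_lebesgue_integral_def real_scaleR_def zero[OF that] by simp
  moreover have "0 \<le> C1 * C2 * Beta a b"
    using C1(1) C2(1) pos by (simp add: Beta_def Gamma_real_pos less_imp_le)
  ultimately show "gamma_dominated A (a + b) (add_conv f g)"
    unfolding gamma_dominated_def by (auto intro!: exI[of _ "C1 * C2 * Beta a b"])
qed

text \<open>Domination makes both integrands integrable; a nonintegrable upper integrand would have
  Bochner integral 0 and could break the inequality.\<close>

lemma add_conv_mono:
  assumes "gamma_dominated A a f" "gamma_dominated A a f'" "gamma_dominated A b g" "gamma_dominated A b g'" "0 < a" "0 < b"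
    and "\<And>y. f y \<le> f' y" "\<And>y. g y \<le> g' y"
  shows "add_conv f g y \<le> add_conv f' g' y"
  unfolding add_conv_def
  using assms set_integrable_add_conv[OF assms(1,3,5,6)] set_integrable_add_conv[OF assms(2,4,5,6)]
  by (intro set_integral_mono mult_mono) (auto intro: gamma_dominatedD(2))

lemma gamma_dominated_iterated_conv:
  assumes "1 \<le> q" and "\<And>h. h \<in> {1..q} \<Longrightarrow> gamma_dominated A (d h) (f h)" and "\<And>h. h \<in> {1..q} \<Longrightarrow> 0 < d h"
  shows "gamma_dominated A (\<Sum>h=1..q. d h) (iterated_conv add_conv q f)"
  using assms
proof (induction q rule: nat_induct_at_least)
  case (Suc q)
  have "0 < (\<Sum>h=1..q. d h)" using Suc by (intro sum_pos) auto
  then have "gamma_dominated A ((\<Sum>h=1..q. d h) + d (Suc q)) (add_conv (iterated_conv add_conv q f) (f (Suc q)))"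
    using Suc by (intro gamma_dominated_add_conv) auto
  then show ?case using Suc by (simp add: iterated_conv_Suc)
qed simp

text \<open>This carries bounds on the single factors over to the whole convolution, provided that
  all factors share the growth rate \<open>A\<close>.\<close>

lemma iterated_conv_mono:
  assumes "1 \<le> q" and "\<And>h. h \<in> {1..q} \<Longrightarrow> gamma_dominated A (d h) (f h)" and "\<And>h. h \<in> {1..q} \<Longrightarrow> gamma_dominated A (d h) (f' h)"
    and "\<And>h. h \<in> {1..q} \<Longrightarrow> 0 < d h" and "\<And>h y. h \<in> {1..q} \<Longrightarrow> f h y \<le> f' h y"
  shows "iterated_conv add_conv q f y \<le> iterated_conv add_conv q f' y"
  using assms
proof (induction q arbitrary: y rule: nat_induct_at_least)
  case (Suc q)
  have "0 < (\<Sum>h=1..q. d h)" using Suc by (intro sum_pos) auto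
  then have "add_conv (iterated_conv add_conv q f) (f (Suc q)) y
     \<le> add_conv (iterated_conv add_conv q f') (f' (Suc q)) y"
    using Suc by (intro add_conv_mono[of A "\<Sum>h=1..q. d h" _ _ "d (Suc q)"] gamma_dominated_iterated_conv) auto
  then show ?case using Suc by (simp add: iterated_conv_Suc)
qed simp

text \<open>Exponential tilting, dilation and scalar factors all commute with convolution. This one identity
  yields the change \<open>\<tau> \<mapsto> y / \<tau>\<close> of scale, the dilation estimate for \<open>F\<close>, and the reduction of the mixed-type
  matrix to shifted parameters.\<close>

lemma add_conv_transform:
  fixes l :: real
  assumes "0 < l"
  shows "add_conv (\<lambda>v. K * exp (c * v) * f (l * v)) (\<lambda>v. K' * exp (c * v) * g (l * v)) y
    = K * K' / l * exp (c * y) * add_conv f g (l * y)"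
proof -
  let ?G = "\<lambda>u. indicator {0..l * y} u * (f u * g (l * y - u))"
  have "(\<integral>u. ?G u \<partial>lborel) = \<bar>l\<bar> *\<^sub>R (\<integral>u. ?G (0 + l * u) \<partial>lborel)"
    using assms by (intro lborel_integral_real_affine) auto
  then have 1: "(\<integral>u. ?G (l * u) \<partial>lborel) = (\<integral>u. ?G u \<partial>lborel) / l"
    using assms by simp
  have 2: "indicator {0..y} u * (K * exp (c * u) * f (l * u) * (K' * exp (c * (y - u)) * g (l * (y - u))))
     = K * K' * exp (c * y) * ?G (l * u)" for u
  proof -
    have "exp (c * y) = exp (c * u) * exp (c * (y - u))"
      by (simp add: exp_add[symmetric] algebra_simps)
    moreover have "indicator {0..y} u = (indicator {0..l * y} (l * u) :: real)"
      using assms by (auto simp: indicator_def zero_le_mult_iff)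
    moreover have "l * y - l * u = l * (y - u)" by (simp add: algebra_simps)
    ultimately show ?thesis by (simp only: mult_ac)
  qed
  show ?thesis
    unfolding add_conv_def set_lebesgue_integral_def real_scaleR_def 2 integral_mult_right_zero 1
    by simp
qed

text \<open>There are \<open>q - 1\<close> convolutions, and each contributes one Jacobian factor
  \<open>1 / l\<close>. The tilt \<open>c\<close> and the dilation \<open>l\<close> are common to
  all factors.\<close>

lemma iterated_conv_transform:
  fixes l :: real
  assumes "1 \<le> q" "0 < l"
  shows "iterated_conv add_conv q (\<lambda>h v. K h * exp (c * v) * f h (l * v)) y
    = (\<Prod>h=1..q. K h) / l ^ (q - 1) * exp (c * y) * iterated_conv add_conv q f (l * y)"
  using assms(1)
proof (induction q arbitrary: y rule: nat_induct_at_least)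
  case (Suc q)
  have l: "l * l ^ (q - Suc 0) = l ^ q" using Suc by (cases q) auto
  have IH: "iterated_conv add_conv q (\<lambda>h v. K h * exp (c * v) * f h (l * v))
    = (\<lambda>v. (\<Prod>h=1..q. K h) / l ^ (q - 1) * exp (c * v) * iterated_conv add_conv q f (l * v))"
    using Suc by auto
  show ?case
    unfolding iterated_conv_Suc[OF Suc(1)] IH add_conv_transform[OF assms(2)]
    by (simp add: l[symmetric])
qed simp

section \<open>The logarithmic substitution from Mellin to additive convolution\<close>

lemma
  fixes f :: "real \<Rightarrow> real"
  assumes [measurable]: "f \<in> borel_measurable borel"
  shows set_integrable_exp_minus_subst:
      "set_integrable lborel {0<..} (\<lambda>s. exp (- s) * f (exp (- s))) \<longleftrightarrow> set_integrable lborel {0<..<1} f"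
    and LBINT_exp_minus_subst:
      "(LBINT s:{0<..}. exp (- s) * f (exp (- s))) = (LBINT x:{0<..<1}. f x)"
proof -
  have img: "(\<lambda>s. exp (- s)) ` {0<..} = {0<..<1::real}"
  proof safe
    fix x :: real assume "x \<in> {0<..<1}"
    then show "x \<in> (\<lambda>s. exp (- s)) ` {0<..}"
      by (intro image_eqI[of _ _ "- ln x"]) auto
  qed auto
  \<comment> \<open>The change of variables theorem concerns absolute integrability for the
    completed Lebesgue measure; Borel measurability brings it back to \<open>lborel\<close>
    below.\<close>
  have iff: "(\<lambda>s. exp (- s) * f (exp (- s))) absolutely_integrable_on {0<..} \<and>
      integral {0<..} (\<lambda>s. exp (- s) * f (exp (- s))) = b
    \<longleftrightarrow> f absolutely_integrable_on {0<..<1} \<and> integral {0<..<1} f = b" for b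
  proof -
    have "((\<lambda>s::real. exp (- s)) has_field_derivative - exp (- s)) (at s within {0<..})" for s
      by (auto intro!: derivative_eq_intros)
    moreover have "inj_on (\<lambda>s::real. exp (- s)) {0<..}" by (auto intro: inj_onI)
    ultimately show ?thesis
      using has_absolute_integral_change_of_variables_1'[of "{0<..}" "\<lambda>s. exp (- s)" "\<lambda>s. - exp (- s)" f b]
      by (simp add: img)
  qed
  have m1: "(\<lambda>s. indicator {0<..} s *\<^sub>R (exp (- s) * f (exp (- s)))) \<in> borel_measurable lborel"
    and m2: "(\<lambda>x. indicator {0<..<1} x *\<^sub>R f x) \<in> borel_measurable lborel"
    by measurable
  show 1: "set_integrable lborel {0<..} (\<lambda>s. exp (- s) * f (exp (- s))) \<longleftrightarrow> set_integrable lborel {0<..<1} f"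
    using iff integrable_completion[OF m1] integrable_completion[OF m2]
    by (auto simp: set_integrable_def)
  show "(LBINT s:{0<..}. exp (- s) * f (exp (- s))) = (LBINT x:{0<..<1}. f x)"
  proof (cases "set_integrable lborel {0<..<1} f")
    case True
    then show ?thesis
      using iff 1 integrable_completion[OF m1] integrable_completion[OF m2]
      by (auto simp: set_borel_integral_eq_integral set_integrable_def)
  next
    \<comment> \<open>Without integrability both Bochner integrals take the default value 0.\<close>
    case False
    with 1 show ?thesis
      by (simp add: set_integrable_def set_lebesgue_integral_def not_integrable_integral_eq)
  qed
qed

text \<open>With \<open>t = exp (- v)\<close> the measure \<open>dt / t\<close> becomes
  \<open>dv\<close>. The vanishing of both factors from 1 onwards cuts the range of \<open>v\<close>
  down to \<open>{0..s}\<close>.\<close>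

lemma mellin_conv_exp_minus:
  fixes f g :: "real \<Rightarrow> real"
  assumes [measurable]: "f \<in> borel_measurable borel" "g \<in> borel_measurable borel"
    and zero: "\<And>x. x \<ge> 1 \<Longrightarrow> f x = 0" "\<And>x. x \<ge> 1 \<Longrightarrow> g x = 0"
  shows "mellin_conv f g (exp (- s)) = add_conv (\<lambda>v. f (exp (- v))) (\<lambda>v. g (exp (- v))) s"
proof -
  let ?h = "\<lambda>t. f t * g (exp (- s) / t) / t"
  have "mellin_conv f g (exp (- s)) = (LBINT t:{0<..<1}. ?h t)"
    unfolding mellin_conv_def set_lebesgue_integral_def
    by (intro Bochner_Integration.integral_cong) (auto simp: indicator_def zero)
  also have "\<dots> = (LBINT v:{0<..}. exp (- v) * ?h (exp (- v)))"
    by (rule LBINT_exp_minus_subst[symmetric]) measurable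
  also have "\<dots> = (LBINT v:{0..s}. f (exp (- v)) * g (exp (- (s - v))))"
    unfolding set_lebesgue_integral_def
  proof (intro Bochner_Integration.integral_cong refl)
    fix v :: real
    have "exp (- s) / exp (- v) = exp (- (s - v))"
      by (simp add: exp_diff[symmetric])
    \<comment> \<open>The indicators can differ only for \<open>v = 0\<close>, where
      \<open>f\<close> is taken at 1, and for \<open>v > s\<close>, where \<open>g\<close> is taken
      beyond 1.\<close>
    then show "indicator {0<..} v *\<^sub>R (exp (- v) * ?h (exp (- v)))
        = indicator {0..s} v *\<^sub>R (f (exp (- v)) * g (exp (- (s - v))))"
      using zero[of "exp (- (s - v))"] zero(1)[of "exp (- v)"]
      by (auto simp: indicator_def)
  qed
  finally show ?thesis by (simp add: add_conv_def)
qed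

lemma iterated_mellin_conv_exp_minus:
  assumes "1 \<le> q" and "\<And>h. h \<in> {1..q} \<Longrightarrow> f h \<in> borel_measurable borel"
    and "\<And>h x. h \<in> {1..q} \<Longrightarrow> x \<ge> 1 \<Longrightarrow> f h x = 0"
  shows "iterated_conv mellin_conv q f (exp (- s))
    = iterated_conv add_conv q (\<lambda>h v. f h (exp (- v))) s"
proof -
  \<comment> \<open>The vanishing for \<open>x \<ge> 1\<close> is carried through the induction,
    because the next convolution requires it of its left factor.\<close>
  have "(\<forall>s. iterated_conv mellin_conv q f (exp (- s))
    = iterated_conv add_conv q (\<lambda>h v. f h (exp (- v))) s) \<and> (\<forall>x\<ge>1. iterated_conv mellin_conv q f x = 0)"
    using assms
  proof (induction q rule: nat_induct_at_least)
    case (Suc q)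
    let ?F = "iterated_conv mellin_conv q f"
    have m: "?F \<in> borel_measurable borel"
      using Suc by (intro borel_measurable_iterated_conv) auto
    have z: "\<And>x. x \<ge> 1 \<Longrightarrow> ?F x = 0" using Suc by auto
    have IH: "(\<lambda>v. ?F (exp (- v))) = iterated_conv add_conv q (\<lambda>h v. f h (exp (- v)))"
      using Suc by auto
    have 1: "mellin_conv ?F (f (Suc q)) (exp (- s))
       = add_conv (\<lambda>v. ?F (exp (- v))) (\<lambda>v. f (Suc q) (exp (- v))) s" for s
      using Suc z m by (intro mellin_conv_exp_minus) auto
    have "mellin_conv ?F (f (Suc q)) x = 0" if "x \<ge> 1" for x
    proof -
      \<comment> \<open>The product of \<open>t\<close> and \<open>x / t\<close> is
        \<open>x \<ge> 1\<close>, so one of them is at least 1.\<close>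
      have "t \<ge> 1 \<or> x / t \<ge> 1" if "t > 0" for t
        using that \<open>x \<ge> 1\<close> by (auto simp: field_simps)
      then have *: "indicator {0<..} t *\<^sub>R (?F t * f (Suc q) (x / t) / t) = 0" for t
        using z[of t] Suc.prems(2)[of "Suc q" "x / t"] by (cases "t > 0") fastforce+
      show ?thesis
        unfolding mellin_conv_def[of ?F] set_lebesgue_integral_def * by simp
    qed
    with Suc(1) 1 IH show ?case by (simp add: iterated_conv_Suc)
  qed simp
  then show ?thesis by blast
qed

section \<open>Gamma kernels and beta weights in the logarithmic variable\<close>

text \<open>Lowering the rate to a common \<open>r\<close> lets kernels with different rates share
  one domination parameter, as iterated convolution demands.\<close>

lemma gamma_dominated_gamma_kernel:
  assumes "r \<le> \<rho>" "0 < d"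
  shows "gamma_dominated (- r) d (gamma_kernel \<rho> d)"
proof -
  have "gamma_kernel \<rho> d y \<le> (1 / Gamma d) * (y powr (d - 1) * exp (- r * y))" if "y > 0" for y
    using assms that by (simp add: gamma_kernel_def divide_right_mono mult_left_mono mult_right_mono Gamma_real_pos less_imp_le)
  moreover have "gamma_kernel \<rho> d \<in> borel_measurable borel"
    unfolding gamma_kernel_def[abs_def] by measurable
  moreover have "0 \<le> 1 / Gamma d" using assms by (simp add: Gamma_real_pos less_imp_le)
  ultimately show ?thesis
    unfolding gamma_dominated_def using assms by (auto simp: gamma_kernel_def Gamma_real_pos less_imp_le intro!: exI[of _ "1 / Gamma d"])
qed

lemma gamma_dominated_exp_scale:
  assumes "gamma_dominated A \<delta> f" "0 \<le> K"
  shows "gamma_dominated (c + A) \<delta> (\<lambda>v. K * exp (c * v) * f v)"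
proof -
  note [measurable] = gamma_dominatedD(1)[OF assms(1)]
  obtain C where C: "C \<ge> 0" "\<forall>y>0. f y \<le> C * (y powr (\<delta> - 1) * exp (A * y))"
    using assms(1) by (auto simp: gamma_dominated_def)
  have "K * exp (c * y) * f y \<le> (K * C) * (y powr (\<delta> - 1) * exp ((c + A) * y))" if "y > 0" for y
  proof -
    have "K * exp (c * y) * f y \<le> K * exp (c * y) * (C * (y powr (\<delta> - 1) * exp (A * y)))"
      using C that assms(2) by (intro mult_left_mono) auto
    also have "\<dots> = (K * C) * (y powr (\<delta> - 1) * exp ((c + A) * y))"
      by (simp add: exp_add distrib_right)
    finally show ?thesis .
  qed
  moreover have "(\<lambda>v. K * exp (c * v) * f v) \<in> borel_measurable borel" by measurable
  ultimately show ?thesis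
    unfolding gamma_dominated_def using C(1) assms gamma_dominatedD(2,3)[OF assms(1)]
    by (auto intro!: exI[of _ "K * C"])
qed

text \<open>The weight in the variable \<open>x = exp (- v)\<close>. The two parameters differ by
  \<open>d\<close>, so the normalisation \<open>Gamma d\<close> and the exponent
  \<open>d - 1\<close> are independent of \<open>\<tau>\<close>.\<close>

definition log_beta :: "real \<Rightarrow> real \<Rightarrow> real \<Rightarrow> real \<Rightarrow> real" where
  "log_beta \<tau> \<rho> d v = beta_weight (\<tau> * \<rho> - 1) (\<tau> * \<rho> + d - 1) (exp (- v))"

lemma borel_measurable_beta_weight [measurable]: "beta_weight a b \<in> borel_measurable borel"
  unfolding beta_weight_def[abs_def] by measurable

lemma borel_measurable_log_beta [measurable]: "log_beta \<tau> \<rho> d \<in> borel_measurable borel"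
  unfolding log_beta_def[abs_def] by measurable

lemma log_beta_nonpos: "v \<le> 0 \<Longrightarrow> log_beta \<tau> \<rho> d v = 0"
  by (simp add: log_beta_def beta_weight_def)

lemma log_beta_pos:
  "0 < v \<Longrightarrow> log_beta \<tau> \<rho> d v = exp (- (\<tau> * \<rho> - 1) * v) * (1 - exp (- v)) powr (d - 1) / Gamma d"
  by (simp add: log_beta_def beta_weight_def powr_def algebra_simps)

lemma log_beta_nonneg: "0 < d \<Longrightarrow> 0 \<le> log_beta \<tau> \<rho> d v"
  by (cases "0 < v") (simp_all add: log_beta_pos log_beta_nonpos Gamma_real_pos less_imp_le)

text \<open>At \<open>x = exp (- v)\<close> the power \<open>x powr (\<tau> * \<xi>)\<close> is an
  exponential. It changes the rate and leaves \<open>d\<close> fixed, because both beta parameters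
  move together.\<close>

lemma log_beta_shift: "exp (- (\<tau> * \<xi>) * v) * log_beta \<tau> \<rho> d v = log_beta \<tau> (\<rho> + \<xi>) d v"
proof (cases "0 < v")
  case True
  have "exp (- (\<tau> * (\<rho> + \<xi>) - 1) * v) = exp (- (\<tau> * \<xi>) * v) * exp (- (\<tau> * \<rho> - 1) * v)"
    by (simp add: exp_add[symmetric] algebra_simps)
  with True show ?thesis by (simp add: log_beta_pos)
qed (simp add: log_beta_nonpos)

lemma one_minus_exp_bounds:
  fixes v :: real
  assumes "0 < v"
  shows "v * exp (- v) \<le> 1 - exp (- v)" "1 - exp (- v) \<le> v" "0 < 1 - exp (- v)"
proof -
  have "(1 + v) * exp (- v) \<le> exp v * exp (- v)"
    by (intro mult_right_mono exp_ge_add_one_self) auto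
  then show "v * exp (- v) \<le> 1 - exp (- v)"
    by (simp add: exp_add[symmetric] distrib_right)
  show "1 - exp (- v) \<le> v" using exp_ge_add_one_self[of "- v"] by simp
  show "0 < 1 - exp (- v)" using assms by simp
qed

text \<open>Raising \<open>v * exp (- v) \<le> 1 - exp (- v) \<le> v\<close> to the power
  \<open>e\<close> reverses the order for \<open>e < 0\<close>. Exponential factors with
  \<open>\<bar>e\<bar>\<close> on both sides cover either sign.\<close>

lemma one_minus_exp_powr_bounds:
  fixes v :: real
  assumes "0 < v"
  shows "v powr e * exp (- \<bar>e\<bar> * v) \<le> (1 - exp (- v)) powr e"
    and "(1 - exp (- v)) powr e \<le> v powr e * exp (\<bar>e\<bar> * v)"
proof -
  note b = one_minus_exp_bounds[OF assms]
  have eq: "(v * exp (- v)) powr e = v powr e * exp (- e * v)"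
    using assms by (simp add: powr_mult) (simp add: powr_def)
  have "v powr e * exp (- \<bar>e\<bar> * v) \<le> (1 - exp (- v)) powr e
    \<and> (1 - exp (- v)) powr e \<le> v powr e * exp (\<bar>e\<bar> * v)"
  proof (cases "e \<ge> 0")
    case True
    have "(v * exp (- v)) powr e \<le> (1 - exp (- v)) powr e" "(1 - exp (- v)) powr e \<le> v powr e"
      using b True assms by (auto intro!: powr_mono2)
    moreover have "v powr e * 1 \<le> v powr e * exp (\<bar>e\<bar> * v)"
      using assms by (intro mult_left_mono) auto
    ultimately show ?thesis using True unfolding eq by auto
  next
    case False
    have "(1 - exp (- v)) powr e \<le> (v * exp (- v)) powr e" "v powr e \<le> (1 - exp (- v)) powr e"
      using b False assms by (auto intro!: powr_mono2')
    moreover have "v powr e * exp (- \<bar>e\<bar> * v) \<le> v powr e * 1"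
      using assms by (intro mult_left_mono) auto
    ultimately show ?thesis using False unfolding eq by auto
  qed
  then show "v powr e * exp (- \<bar>e\<bar> * v) \<le> (1 - exp (- v)) powr e"
    "(1 - exp (- v)) powr e \<le> v powr e * exp (\<bar>e\<bar> * v)" by auto
qed

text \<open>The loss in the rate is at most \<open>\<bar>d - 1\<bar>\<close> from the power of
  \<open>1 - exp (- v)\<close> plus 1 from the exponent \<open>\<tau> * \<rho> - 1\<close>, and
  \<open>d + 2\<close> exceeds this sum for \<open>d > 0\<close>. A free \<open>c\<close> lets
  several factors use one constant.\<close>

lemma log_beta_bounds:
  assumes "0 < v" "0 < d" "d + 2 \<le> c"
  shows "v powr (d - 1) * exp (- (\<tau> * \<rho> + c) * v) / Gamma d \<le> log_beta \<tau> \<rho> d v"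
    and "log_beta \<tau> \<rho> d v \<le> v powr (d - 1) * exp (- (\<tau> * \<rho> - c) * v) / Gamma d"
proof -
  note b = one_minus_exp_powr_bounds[OF assms(1), of "d - 1"]
  have G: "0 < Gamma d" using assms by (simp add: Gamma_real_pos)
  have c: "\<bar>d - 1\<bar> * v + v \<le> c * v" "- c * v \<le> - \<bar>d - 1\<bar> * v + v"
  proof -
    have "(\<bar>d - 1\<bar> + 1) * v \<le> c * v" using assms by (intro mult_right_mono) auto
    moreover have "- c * v \<le> (- \<bar>d - 1\<bar> + 1) * v" using assms by (intro mult_right_mono) auto
    ultimately show "\<bar>d - 1\<bar> * v + v \<le> c * v" "- c * v \<le> - \<bar>d - 1\<bar> * v + v"
      by (simp_all add: algebra_simps)
  qed
  have "v powr (d - 1) * exp (- (\<tau> * \<rho> + c) * v)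
      \<le> v powr (d - 1) * (exp (- (\<tau> * \<rho> - 1) * v) * exp (- \<bar>d - 1\<bar> * v))"
    using c by (intro mult_left_mono) (auto simp: exp_add[symmetric] algebra_simps)
  also have "\<dots> \<le> exp (- (\<tau> * \<rho> - 1) * v) * (1 - exp (- v)) powr (d - 1)"
    using mult_left_mono[OF b(1), of "exp (- (\<tau> * \<rho> - 1) * v)"] by (simp add: mult_ac)
  finally show "v powr (d - 1) * exp (- (\<tau> * \<rho> + c) * v) / Gamma d \<le> log_beta \<tau> \<rho> d v"
    using G assms by (simp add: log_beta_pos divide_right_mono)
  have "exp (- (\<tau> * \<rho> - 1) * v) * (1 - exp (- v)) powr (d - 1)
      \<le> v powr (d - 1) * (exp (- (\<tau> * \<rho> - 1) * v) * exp (\<bar>d - 1\<bar> * v))"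
    using mult_left_mono[OF b(2), of "exp (- (\<tau> * \<rho> - 1) * v)"] by (simp add: mult_ac)
  also have "\<dots> \<le> v powr (d - 1) * exp (- (\<tau> * \<rho> - c) * v)"
    using c by (intro mult_left_mono) (auto simp: exp_add[symmetric] algebra_simps)
  finally show "log_beta \<tau> \<rho> d v \<le> v powr (d - 1) * exp (- (\<tau> * \<rho> - c) * v) / Gamma d"
    using G assms by (simp add: log_beta_pos divide_right_mono)
qed

text \<open>Near \<open>v = 0\<close> and \<open>v = \<infinity>\<close> at once: \<open>1 - e\<^sup>-\<^sup>v \<ge> \<delta> v e\<^sup>-\<^sup>\<delta>\<^sup>v\<close> for \<open>\<delta> \<le> 1\<close>, so for
  \<open>d < 1\<close> an arbitrarily small part of the decay rate \<open>\<tau> r\<close> pays for the singularity.\<close>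

lemma gamma_dominated_log_beta:
  assumes "0 < \<tau>" "0 < r" "r \<le> \<rho>" "0 < d"
  shows "gamma_dominated (1 - \<tau> * r / 2) d (log_beta \<tau> \<rho> d)"
proof -
  define \<delta> where "\<delta> = min 1 (\<tau> * r / 2)"
  define \<kappa> where "\<kappa> = \<tau> * r / 2"
  have \<delta>: "0 < \<delta>" "\<delta> \<le> 1" "\<delta> \<le> \<kappa>" using assms by (auto simp: \<delta>_def \<kappa>_def)
  \<comment> \<open>The entry 1 serves \<open>d \<ge> 1\<close>; the other one appears for
    \<open>d < 1\<close>, when \<open>\<delta>\<close> is pulled out of the power.\<close>
  define C where "C = max 1 (\<delta> powr (d - 1))"
  \<comment> \<open>Of the rate \<open>\<tau> * r = 2 * \<kappa>\<close> one half is spent on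
    \<open>exp (\<kappa> * v)\<close> in the bound for the power; the other half remains as
    decay.\<close>
  have \<kappa>: "0 < \<kappa>" "2 * \<kappa> \<le> \<tau> * \<rho>" using assms by (auto simp: \<kappa>_def)
  have pw: "(1 - exp (- v)) powr (d - 1) \<le> C * (v powr (d - 1) * exp (\<kappa> * v))" if "v > 0" for v
  proof (cases "d \<ge> 1")
    case True
    have "(1 - exp (- v)) powr (d - 1) \<le> v powr (d - 1)"
      using True one_minus_exp_bounds[OF that] that by (intro powr_mono2) auto
    also have "\<dots> = 1 * (v powr (d - 1) * 1)" by simp
    also have "\<dots> \<le> C * (v powr (d - 1) * exp (\<kappa> * v))"
      using \<kappa> that by (intro mult_mono) (auto simp: C_def)
    finally show ?thesis .
  next
    case False
    have "\<delta> * v * exp (- (\<delta> * v)) \<le> 1 - exp (- (\<delta> * v))"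
      using one_minus_exp_bounds(1)[of "\<delta> * v"] \<delta> that by simp
    also have "\<dots> \<le> 1 - exp (- v)" using \<delta> that by simp
    finally have "(1 - exp (- v)) powr (d - 1) \<le> (\<delta> * v * exp (- (\<delta> * v))) powr (d - 1)"
      using False \<delta> that by (intro powr_mono2') auto
    also have "\<dots> = \<delta> powr (d - 1) * (v powr (d - 1) * exp ((1 - d) * (\<delta> * v)))"
      using \<delta> that by (simp add: powr_mult) (simp add: powr_def algebra_simps)
    also have "\<dots> \<le> C * (v powr (d - 1) * exp (\<kappa> * v))"
    proof (intro mult_mono)
      have "(1 - d) * \<delta> \<le> 1 * \<kappa>" using \<delta> False assms by (intro mult_mono) auto
      then have "(1 - d) * \<delta> * v \<le> \<kappa> * v" using that by (intro mult_right_mono) auto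
      then show "exp ((1 - d) * (\<delta> * v)) \<le> exp (\<kappa> * v)" by (simp add: mult.assoc)
    qed (auto simp: C_def)
    finally show ?thesis .
  qed
  have G: "0 < Gamma d" using assms by (simp add: Gamma_real_pos)
  have "log_beta \<tau> \<rho> d v \<le> (C / Gamma d) * (v powr (d - 1) * exp ((1 - \<kappa>) * v))" if "v > 0" for v
  proof -
    have "exp (- (\<tau> * \<rho> - 1) * v) * (1 - exp (- v)) powr (d - 1)
      \<le> exp (- (2 * \<kappa> - 1) * v) * (C * (v powr (d - 1) * exp (\<kappa> * v)))"
      using pw[OF that] \<kappa> that by (intro mult_mono) auto
    also have "\<dots> = C * (v powr (d - 1) * (exp (- (2 * \<kappa> - 1) * v) * exp (\<kappa> * v)))"
      by simp
    also have "exp (- (2 * \<kappa> - 1) * v) * exp (\<kappa> * v) = exp ((1 - \<kappa>) * v)"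
      by (simp add: exp_add[symmetric] algebra_simps)
    finally show ?thesis using G that by (simp add: log_beta_pos divide_right_mono)
  qed
  moreover have "0 \<le> C / Gamma d" using G by (simp add: C_def le_max_iff_disj)
  ultimately show ?thesis
    unfolding gamma_dominated_def \<kappa>_def[symmetric] using assms log_beta_nonneg log_beta_nonpos
    by (auto intro!: exI[of _ "C / Gamma d"])
qed

section \<open>Integrability of powers times exponentials, and growth of polynomials\<close>

lemma set_integrable_powr_exp:
  fixes a k :: real
  assumes "0 < a" "0 < k"
  shows "set_integrable lborel {0<..} (\<lambda>t. t powr (a - 1) * exp (- k * t))"
proof -
  let ?f = "\<lambda>t. complex_of_real t powr (complex_of_real a - 1) / of_real (exp (k * t))"
  have "?f absolutely_integrable_on {0<..}"
    using assms by (intro absolutely_integrable_Gamma_integral) auto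
  \<comment> \<open>Taking norms turns the complex Gamma integrand into the real function at
    hand.\<close>
  then have "(\<lambda>t. norm (?f t)) absolutely_integrable_on {0<..}"
    by (rule absolutely_integrable_norm[unfolded comp_def])
  also have "?this \<longleftrightarrow> (\<lambda>t. t powr (a - 1) * exp (- k * t)) absolutely_integrable_on {0<..}"
    by (intro set_integrable_cong) (auto simp: norm_divide norm_powr_real_powr exp_minus field_simps)
  finally have "integrable lebesgue (\<lambda>t. indicator {0<..} t *\<^sub>R (t powr (a - 1) * exp (- k * t)))"
    by (simp add: set_integrable_def)
  then show ?thesis
    unfolding set_integrable_def by (subst (asm) integrable_completion) auto
qed

text \<open>Horner induction: one half of \<open>\<delta>\<close> bounds the factor
  \<open>y\<close>, the other half the remaining polynomial.\<close>

lemma poly_exp_bound: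
  fixes P :: "real poly"
  assumes "0 < \<delta>"
  shows "\<exists>M. \<forall>y>0. \<bar>poly P y\<bar> \<le> M * exp (\<delta> * y)"
  using assms
proof (induction P arbitrary: \<delta>)
  case 0
  then show ?case by (intro exI[of _ 0]) auto
next
  case (pCons a P)
  then obtain M where M: "\<forall>y>0. \<bar>poly P y\<bar> \<le> M * exp (\<delta> / 2 * y)" by (meson half_gt_zero)
  have "\<bar>poly (pCons a P) y\<bar> \<le> (\<bar>a\<bar> + 2 / \<delta> * M) * exp (\<delta> * y)" if "y > 0" for y
  proof -
    have "y \<le> 2 / \<delta> * exp (\<delta> / 2 * y)"
      using exp_ge_add_one_self[of "\<delta> / 2 * y"] pCons.prems by (simp add: field_simps)
    then have "y * \<bar>poly P y\<bar> \<le> (2 / \<delta> * exp (\<delta> / 2 * y)) * (M * exp (\<delta> / 2 * y))"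
      using M that pCons.prems by (intro mult_mono) auto
    also have "\<dots> = 2 / \<delta> * M * (exp (\<delta> / 2 * y) * exp (\<delta> / 2 * y))" by simp
    also have "exp (\<delta> / 2 * y) * exp (\<delta> / 2 * y) = exp (\<delta> * y)"
      by (simp add: exp_add[symmetric])
    finally have 1: "y * \<bar>poly P y\<bar> \<le> 2 / \<delta> * M * exp (\<delta> * y)" .
    have 2: "\<bar>a\<bar> * 1 \<le> \<bar>a\<bar> * exp (\<delta> * y)"
      using that pCons.prems by (intro mult_left_mono) auto
    have "\<bar>poly (pCons a P) y\<bar> \<le> \<bar>a\<bar> + y * \<bar>poly P y\<bar>"
      using that abs_triangle_ineq[of a "y * poly P y"] by (simp add: abs_mult)
    then show ?thesis using 1 2 by (simp add: distrib_right)
  qed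
  then show ?case by blast
qed

section \<open>Parameter shifts induced by powers of \<open>x\<close> and exponentials of
  \<open>y\<close>\<close>

lemma iterated_beta_weight_shift:
  assumes "1 \<le> q" "0 < x"
  shows "x powr (\<tau> * \<xi>) * iterated_conv mellin_conv q (\<lambda>h. beta_weight (\<tau> * \<rho> h - 1) (\<tau> * \<rho> h + d h - 1)) x
    = iterated_conv mellin_conv q (\<lambda>h. beta_weight (\<tau> * (\<rho> h + \<xi>) - 1) (\<tau> * (\<rho> h + \<xi>) + d h - 1)) x"
proof -
  \<comment> \<open>In the variable \<open>s\<close> the factor
    \<open>x powr (\<tau> * \<xi>)\<close> is the exponential tilt
    \<open>exp (- (\<tau> * \<xi>) * s)\<close>, which can be distributed over all factors; the
    dilation is trivial, \<open>l = 1\<close>.\<close>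
  define s where "s = - ln x"
  have x: "x = exp (- s)" using assms by (simp add: s_def)
  have 1: "iterated_conv mellin_conv q (\<lambda>h. beta_weight (\<tau> * \<rho> h - 1) (\<tau> * \<rho> h + d h - 1)) x
    = iterated_conv add_conv q (\<lambda>h. log_beta \<tau> (\<rho> h) (d h)) s" for \<rho>
    unfolding log_beta_def[abs_def] x using assms(1)
    by (intro iterated_mellin_conv_exp_minus) (auto simp: beta_weight_def)
  show ?thesis
    unfolding 1 using iterated_conv_transform[of q 1 "\<lambda>_. 1" "- (\<tau> * \<xi>)" "\<lambda>h. log_beta \<tau> (\<rho> h) (d h)" s] assms
    by (simp add: log_beta_shift[simplified] s_def powr_def)
qed

text \<open>The limit counterpart of the preceding identity. Together they reduce the mixed-type
  matrix to ordinary rows with rates \<open>\<rho> h + \<xi>\<close>.\<close>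

lemma iterated_gamma_kernel_shift:
  assumes "1 \<le> q"
  shows "exp (- \<xi> * y) * iterated_conv add_conv q (\<lambda>h. gamma_kernel (\<rho> h) (d h)) y
    = iterated_conv add_conv q (\<lambda>h. gamma_kernel (\<rho> h + \<xi>) (d h)) y"
proof -
  have "(\<lambda>v. exp (- (\<xi> * v)) * gamma_kernel \<rho> d v) = gamma_kernel (\<rho> + \<xi>) d" for \<rho> d
    by (auto simp: gamma_kernel_def fun_eq_iff exp_add[symmetric] algebra_simps)
  then show ?thesis
    using iterated_conv_transform[of q 1 "\<lambda>_. 1" "- \<xi>" "\<lambda>h. gamma_kernel (\<rho> h) (d h)" y] assms
    by simp
qed

section \<open>Densities\<close>

lemma density_on_cong:
  assumes "\<And>x. x \<in> S \<Longrightarrow> f x = g x"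
  shows "density_on S f = density_on S g"
  unfolding density_on_def density_def
  using assms by (simp add: space_restrict_space cong: nn_integral_cong_simp)

lemma sets_density_on: "sets (density_on S f) = sets (restrict_space borel S)"
  unfolding density_on_def by (simp add: sets_restrict_space)

lemma space_density_on: "space (density_on S f) = S"
  by (simp add: density_on_def space_restrict_space)

lemma emeasure_density_on:
  assumes [measurable]: "f \<in> borel_measurable borel" "S \<in> sets borel" and A: "A \<in> sets borel" "A \<subseteq> S"
  shows "emeasure (density_on S f) A = (\<integral>\<^sup>+ x. ennreal (f x) * indicator A x \<partial>lborel)"
proof -
  have "(\<lambda>x. ennreal (f x)) \<in> borel_measurable (restrict_space lborel S)"
    by (intro measurable_restrict_space1) measurable
  moreover have "A \<in> sets (restrict_space lborel S)"
    using A by (auto simp: sets_restrict_space)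
  ultimately have "emeasure (density_on S f) A
      = (\<integral>\<^sup>+ x. ennreal (f x) * indicator A x \<partial>restrict_space lborel S)"
    unfolding density_on_def by (rule emeasure_density)
  also have "\<dots> = (\<integral>\<^sup>+ x. ennreal (f x) * indicator A x * indicator S x \<partial>lborel)"
    by (intro nn_integral_restrict_space) simp
  also have "\<dots> = (\<integral>\<^sup>+ x. ennreal (f x) * indicator A x \<partial>lborel)"
    using A(2) by (intro nn_integral_cong) (auto simp: indicator_def)
  finally show ?thesis .
qed

text \<open>Test functions are measurable on \<open>{0<..}\<close> only, so the density is removed
  inside the restricted space; the indicator enters afterwards.\<close>

lemma
  fixes f \<phi> :: "real \<Rightarrow> real"
  assumes [measurable]: "f \<in> borel_measurable borel" and nonneg: "\<And>y. y > 0 \<Longrightarrow> 0 \<le> f y"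
  shows finite_measure_density_on:
      "set_integrable lborel {0<..} f \<Longrightarrow> finite_measure (density_on {0<..} f)"
    and integral_density_on:
      "\<phi> \<in> borel_measurable (restrict_space borel {0<..}) \<Longrightarrow>
        (\<integral>y. \<phi> y \<partial>density_on {0<..} f) = (LBINT y:{0<..}. \<phi> y * f y)"
proof -
  have [measurable]: "f \<in> borel_measurable (restrict_space lborel {0<..})"
    by (intro measurable_restrict_space1) measurable
  show "finite_measure (density_on {0<..} f)" if "set_integrable lborel {0<..} f"
  proof (rule finite_measureI)
    have "emeasure (density_on {0<..} f) (space (density_on {0<..} f))
      = (\<integral>\<^sup>+ y. ennreal (f y) * indicator {0<..} y \<partial>lborel)"
      unfolding space_density_on by (intro emeasure_density_on) auto
    also have "\<dots> = (\<integral>\<^sup>+ y. ennreal (indicator {0<..} y *\<^sub>R f y) \<partial>lborel)"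
      by (intro nn_integral_cong) (auto simp: indicator_def)
    also have "\<dots> \<noteq> \<infinity>"
      using that nonneg unfolding set_integrable_def
      by (subst nn_integral_eq_integral) (auto simp: indicator_def)
    finally show "emeasure (density_on {0<..} f) (space (density_on {0<..} f)) \<noteq> \<infinity>" .
  qed
  assume "\<phi> \<in> borel_measurable (restrict_space borel {0<..})"
  also have "borel_measurable (restrict_space borel {0<..}) = borel_measurable (restrict_space lborel ({0<..} :: real set))"
    by (intro measurable_cong_sets sets_restrict_space_cong) auto
  finally have [measurable]: "\<phi> \<in> borel_measurable (restrict_space lborel {0<..})" .
  have "(\<integral>y. \<phi> y \<partial>density_on {0<..} f) = (\<integral>y. f y *\<^sub>R \<phi> y \<partial>restrict_space lborel {0<..})"
    unfolding density_on_def using nonneg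
    by (intro integral_density) (auto intro!: AE_I2 simp: space_restrict_space)
  also have "\<dots> = (LBINT y:{0<..}. \<phi> y * f y)"
    unfolding set_lebesgue_integral_def
    by (subst integral_restrict_space) (auto simp: mult.commute)
  finally show "(\<integral>y. \<phi> y \<partial>density_on {0<..} f) = (LBINT y:{0<..}. \<phi> y * f y)" .
qed

section \<open>The limit of the rescaled weight\<close>

text \<open>One row with arbitrary positive exponents and rates, general enough for every row and
  every matrix entry. Uniform bounds replace the individual rates: \<open>r\<close> in upper
  estimates, \<open>R\<close> in lower ones.\<close>

locale gamma_parameters =
  fixes q :: nat and \<rho> d :: "nat \<Rightarrow> real" and r R :: real
  assumes q: "1 \<le> q" and r: "0 < r"
    and \<rho>: "\<And>h. h \<in> {1..q} \<Longrightarrow> r \<le> \<rho> h" "\<And>h. h \<in> {1..q} \<Longrightarrow> \<rho> h \<le> R"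
    and d: "\<And>h. h \<in> {1..q} \<Longrightarrow> 0 < d h"
begin

definition D :: real where "D = (\<Sum>h=1..q. d h)"

definition F :: "real \<Rightarrow> real" where
  "F = iterated_conv add_conv q (\<lambda>h. gamma_kernel (\<rho> h) (d h))"

definition w :: "real \<Rightarrow> real \<Rightarrow> real" where
  "w \<tau> = iterated_conv mellin_conv q (\<lambda>h. beta_weight (\<tau> * \<rho> h - 1) (\<tau> * \<rho> h + d h - 1))"

text \<open>\<open>D\<close> is the exponent sum of the row at hand. For a row with one raised
  exponent, \<open>D - 1\<close> is therefore the sum of the original exponents.\<close>

definition W :: "real \<Rightarrow> real \<Rightarrow> real" where
  "W \<tau> y = \<tau> powr (D - 1) * reflected \<tau> (w \<tau>) y"

lemma D_pos: "0 < D"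
  unfolding D_def using q d by (intro sum_pos) auto

lemma d_le_D: "h \<in> {1..q} \<Longrightarrow> d h \<le> D"
  unfolding D_def using d by (intro member_le_sum) (auto intro: less_imp_le)

lemma gamma_dominated_F: "gamma_dominated (- r) D F"
  unfolding F_def D_def using q \<rho> d
  by (intro gamma_dominated_iterated_conv gamma_dominated_gamma_kernel) auto

lemma F_nonneg: "0 \<le> F y"
  by (rule gamma_dominatedD(2)[OF gamma_dominated_F])

lemma borel_measurable_F [measurable]: "F \<in> borel_measurable borel"
  by (rule gamma_dominatedD(1)[OF gamma_dominated_F])

lemma borel_measurable_w [measurable]: "w \<tau> \<in> borel_measurable borel"
  unfolding w_def using q by (intro borel_measurable_iterated_conv) auto

lemma borel_measurable_W [measurable]: "W \<tau> \<in> borel_measurable borel"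
  unfolding W_def[abs_def] reflected_def by measurable

lemma w_exp_minus: "w \<tau> (exp (- s)) = iterated_conv add_conv q (\<lambda>h. log_beta \<tau> (\<rho> h) (d h)) s"
  unfolding w_def log_beta_def[abs_def] using q
  by (intro iterated_mellin_conv_exp_minus) (auto simp: beta_weight_def)

lemma gamma_dominated_w_exp_minus:
  assumes "0 < \<tau>"
  shows "gamma_dominated (1 - \<tau> * r / 2) D (\<lambda>s. w \<tau> (exp (- s)))"
  unfolding w_exp_minus D_def using assms q r \<rho> d
  by (intro gamma_dominated_iterated_conv gamma_dominated_log_beta) auto

lemma w_nonneg:
  assumes "0 < \<tau>" "0 < x"
  shows "0 \<le> w \<tau> x"
  using gamma_dominatedD(2)[OF gamma_dominated_w_exp_minus[OF assms(1)], of "- ln x"] assms by simp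

lemma W_nonneg: "0 < \<tau> \<Longrightarrow> 0 \<le> W \<tau> y"
  by (auto simp: W_def reflected_def intro!: mult_nonneg_nonneg w_nonneg)

lemma W_eq_0: "\<not> (0 < y \<and> y < \<tau>) \<Longrightarrow> W \<tau> y = 0"
  by (auto simp: W_def reflected_def)

section \<open>Comparison of the rescaled weight with the limit density\<close>

lemma prod_powr_D:
  assumes "0 < l"
  shows "(\<Prod>h=1..q. l powr (d h - 1)) = l powr (D - real q)"
  using assms by (simp add: powr_sum[symmetric] sum_subtractf D_def)

lemma iterated_gamma_exp_scale:
  assumes "0 < l"
  shows "iterated_conv add_conv q (\<lambda>h v. l powr (d h - 1) * exp (\<kappa> * v) * gamma_kernel (\<rho> h) (d h) v) y
    = l powr (D - real q) * exp (\<kappa> * y) * F y"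
  using iterated_conv_transform[of q 1 "\<lambda>h. l powr (d h - 1)" \<kappa> "\<lambda>h. gamma_kernel (\<rho> h) (d h)" y] q
  by (simp add: prod_powr_D[OF assms, simplified] F_def)

lemma gamma_dominated_gamma_exp_scale:
  assumes "h \<in> {1..q}"
  shows "gamma_dominated (\<kappa> - r) (d h) (\<lambda>v. l powr (d h - 1) * exp (\<kappa> * v) * gamma_kernel (\<rho> h) (d h) v)"
  using gamma_dominated_exp_scale[OF gamma_dominated_gamma_kernel[OF \<rho>(1)[OF assms] d[OF assms]], of "l powr (d h - 1)" \<kappa>]
  by simp

text \<open>The tilts must not depend on \<open>h\<close>, because only a common tilt commutes with
  convolution. Hence the excess rate \<open>\<rho> h * (\<tau> * l - 1)\<close> is replaced by its
  bounds with \<open>r\<close> and \<open>R\<close>, and \<open>D + 2\<close> serves all factors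
  because \<open>d h \<le> D\<close>.\<close>

lemma log_beta_scaled_bounds:
  assumes h: "h \<in> {1..q}" and l: "0 < l" "1 \<le> \<tau> * l"
  defines "\<kappa> \<equiv> (D + 2) * l - r * (\<tau> * l - 1)" and "\<kappa>' \<equiv> - ((D + 2) * l) - R * (\<tau> * l - 1)"
  shows "l powr (d h - 1) * exp (\<kappa>' * v) * gamma_kernel (\<rho> h) (d h) v \<le> log_beta \<tau> (\<rho> h) (d h) (l * v)"
    and "log_beta \<tau> (\<rho> h) (d h) (l * v) \<le> l powr (d h - 1) * exp (\<kappa> * v) * gamma_kernel (\<rho> h) (d h) v"
proof -
  have "l powr (d h - 1) * exp (\<kappa>' * v) * gamma_kernel (\<rho> h) (d h) v \<le> log_beta \<tau> (\<rho> h) (d h) (l * v) \<and>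
    log_beta \<tau> (\<rho> h) (d h) (l * v) \<le> l powr (d h - 1) * exp (\<kappa> * v) * gamma_kernel (\<rho> h) (d h) v"
  proof (cases "0 < v")
    case False
    then show ?thesis
      using l by (simp add: gamma_kernel_def log_beta_nonpos mult_le_0_iff)
  next
    case True
    have G: "0 < Gamma (d h)" using d[OF h] by (simp add: Gamma_real_pos)
    have lv: "0 < l * v" using l True by simp
    note b = log_beta_bounds[OF lv d[OF h], of "D + 2" \<tau> "\<rho> h"]
    have m: "r * ((\<tau> * l - 1) * v) \<le> \<rho> h * ((\<tau> * l - 1) * v)" "\<rho> h * ((\<tau> * l - 1) * v) \<le> R * ((\<tau> * l - 1) * v)"
      using \<rho>[OF h] l True by (auto intro!: mult_right_mono)
    have e1: "exp (- (\<tau> * \<rho> h - (D + 2)) * (l * v)) \<le> exp (\<kappa> * v) * exp (- \<rho> h * v)"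
      using m(1) unfolding exp_add[symmetric] \<kappa>_def by (simp add: algebra_simps)
    have e2: "exp (\<kappa>' * v) * exp (- \<rho> h * v) \<le> exp (- (\<tau> * \<rho> h + (D + 2)) * (l * v))"
      using m(2) unfolding exp_add[symmetric] \<kappa>'_def by (simp add: algebra_simps)
    have p: "(l * v) powr (d h - 1) = l powr (d h - 1) * v powr (d h - 1)"
      using l True by (simp add: powr_mult)
    have "l powr (d h - 1) * exp (\<kappa>' * v) * gamma_kernel (\<rho> h) (d h) v
      = (l * v) powr (d h - 1) * (exp (\<kappa>' * v) * exp (- \<rho> h * v)) / Gamma (d h)"
      using True by (simp add: gamma_kernel_def p)
    also have "\<dots> \<le> (l * v) powr (d h - 1) * exp (- (\<tau> * \<rho> h + (D + 2)) * (l * v)) / Gamma (d h)"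
      using G e2 by (intro divide_right_mono mult_left_mono) auto
    also have "\<dots> \<le> log_beta \<tau> (\<rho> h) (d h) (l * v)"
      using b(1) d_le_D[OF h] by simp
    finally have 1: "l powr (d h - 1) * exp (\<kappa>' * v) * gamma_kernel (\<rho> h) (d h) v \<le> log_beta \<tau> (\<rho> h) (d h) (l * v)" .
    have "log_beta \<tau> (\<rho> h) (d h) (l * v) \<le> (l * v) powr (d h - 1) * exp (- (\<tau> * \<rho> h - (D + 2)) * (l * v)) / Gamma (d h)"
      using b(2) d_le_D[OF h] by simp
    also have "\<dots> \<le> (l * v) powr (d h - 1) * (exp (\<kappa> * v) * exp (- \<rho> h * v)) / Gamma (d h)"
      using G e1 by (intro divide_right_mono mult_left_mono) auto
    also have "\<dots> = l powr (d h - 1) * exp (\<kappa> * v) * gamma_kernel (\<rho> h) (d h) v"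
      using True by (simp add: gamma_kernel_def p)
    finally show ?thesis using 1 by simp
  qed
  then show "l powr (d h - 1) * exp (\<kappa>' * v) * gamma_kernel (\<rho> h) (d h) v \<le> log_beta \<tau> (\<rho> h) (d h) (l * v)"
    and "log_beta \<tau> (\<rho> h) (d h) (l * v) \<le> l powr (d h - 1) * exp (\<kappa> * v) * gamma_kernel (\<rho> h) (d h) v"
    by auto
qed

text \<open>Dilating the convolution by \<open>l\<close> allows a comparison with \<open>F\<close>
  at the same point \<open>y\<close>. The Jacobians and the factors \<open>l powr (d h - 1)\<close>
  combine to \<open>l powr (D - 1)\<close>.\<close>

lemma w_scaled_bounds:
  assumes \<tau>: "0 < \<tau>" and l: "0 < l" "1 \<le> \<tau> * l"
  shows "(\<tau> * l) powr (D - 1) * exp ((- ((D + 2) * l) - R * (\<tau> * l - 1)) * y) * F y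
      \<le> \<tau> powr (D - 1) * w \<tau> (exp (- (l * y)))"
    and "\<tau> powr (D - 1) * w \<tau> (exp (- (l * y)))
      \<le> (\<tau> * l) powr (D - 1) * exp (((D + 2) * l - r * (\<tau> * l - 1)) * y) * F y"
proof -
  define \<kappa> where "\<kappa> = (D + 2) * l - r * (\<tau> * l - 1)"
  define \<kappa>' where "\<kappa>' = - ((D + 2) * l) - R * (\<tau> * l - 1)"
  define g where "g = (\<lambda>\<kappa> h v. l powr (d h - 1) * exp (\<kappa> * v) * gamma_kernel (\<rho> h) (d h) v)"
  define b where "b = (\<lambda>h v. log_beta \<tau> (\<rho> h) (d h) (l * v))"
  have w: "w \<tau> (exp (- (l * y))) = l ^ (q - 1) * iterated_conv add_conv q b y"
    using iterated_conv_transform[of q l "\<lambda>_. 1" 0 "\<lambda>h. log_beta \<tau> (\<rho> h) (d h)" y] q l(1)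
    by (simp add: w_exp_minus b_def)
  have gb: "g \<kappa>' h v \<le> b h v" "b h v \<le> g \<kappa> h v" if "h \<in> {1..q}" for h v
    unfolding g_def b_def \<kappa>_def \<kappa>'_def using log_beta_scaled_bounds[OF that l] by auto
  \<comment> \<open>Domination descends from \<open>g \<kappa>\<close> to \<open>b\<close> and from
    \<open>b\<close> to \<open>g \<kappa>'\<close>, so all three families share the rate
    \<open>\<kappa> - r\<close>.\<close>
  have k1: "gamma_dominated (\<kappa> - r) (d h) (g \<kappa> h)" if "h \<in> {1..q}" for h
    unfolding g_def by (rule gamma_dominated_gamma_exp_scale[OF that])
  have k2: "gamma_dominated (\<kappa> - r) (d h) (b h)" if "h \<in> {1..q}" for h
  proof (rule gamma_dominated_le[OF k1[OF that]])
    show "b h \<in> borel_measurable borel" unfolding b_def by measurable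
    show "0 \<le> b h v" for v unfolding b_def by (rule log_beta_nonneg[OF d[OF that]])
  qed (rule gb[OF that])
  have k3: "gamma_dominated (\<kappa> - r) (d h) (g \<kappa>' h)" if "h \<in> {1..q}" for h
  proof (rule gamma_dominated_le[OF k2[OF that]])
    have "gamma_dominated (\<kappa>' - r) (d h) (g \<kappa>' h)" unfolding g_def by (rule gamma_dominated_gamma_exp_scale[OF that])
    then show "g \<kappa>' h \<in> borel_measurable borel" "0 \<le> g \<kappa>' h v" for v by (auto dest: gamma_dominatedD)
  qed (rule gb[OF that])
  have it: "\<tau> powr (D - 1) * (l ^ (q - 1) * iterated_conv add_conv q (g \<kappa>) y)
     = (\<tau> * l) powr (D - 1) * exp (\<kappa> * y) * F y" for \<kappa>
  proof -
    have "l ^ (q - 1) = l powr (real q - 1)" using l q by (simp add: powr_realpow[symmetric] of_nat_diff)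
    then have "l ^ (q - 1) * l powr (D - real q) = l powr (D - 1)"
      using l by (simp add: powr_add[symmetric])
    moreover have "(\<tau> * l) powr (D - 1) = \<tau> powr (D - 1) * l powr (D - 1)"
      using \<tau> l by (simp add: powr_mult)
    ultimately show ?thesis
      unfolding g_def iterated_gamma_exp_scale[OF l(1)] by (simp add: mult_ac)
  qed
  have c: "0 \<le> \<tau> powr (D - 1)" "0 \<le> l ^ (q - 1)" using l by auto
  have "iterated_conv add_conv q (g \<kappa>') y \<le> iterated_conv add_conv q b y"
    using q k2 k3 d gb by (intro iterated_conv_mono[of q "\<kappa> - r" d]) auto
  then have "\<tau> powr (D - 1) * (l ^ (q - 1) * iterated_conv add_conv q (g \<kappa>') y)
     \<le> \<tau> powr (D - 1) * (l ^ (q - 1) * iterated_conv add_conv q b y)"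
    using c by (intro mult_left_mono)
  then show "(\<tau> * l) powr (D - 1) * exp ((- ((D + 2) * l) - R * (\<tau> * l - 1)) * y) * F y
      \<le> \<tau> powr (D - 1) * w \<tau> (exp (- (l * y)))"
    unfolding it w \<kappa>'_def .
  have "iterated_conv add_conv q b y \<le> iterated_conv add_conv q (g \<kappa>) y"
    using q k1 k2 d gb by (intro iterated_conv_mono[of q "\<kappa> - r" d]) auto
  then have "\<tau> powr (D - 1) * (l ^ (q - 1) * iterated_conv add_conv q b y)
     \<le> \<tau> powr (D - 1) * (l ^ (q - 1) * iterated_conv add_conv q (g \<kappa>) y)"
    using c by (intro mult_left_mono)
  then show "\<tau> powr (D - 1) * w \<tau> (exp (- (l * y)))
      \<le> (\<tau> * l) powr (D - 1) * exp (((D + 2) * l - r * (\<tau> * l - 1)) * y) * F y"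
    unfolding it w \<kappa>_def .
qed

text \<open>The upper bound has to serve as a majorant throughout \<open>0 < y < \<tau>\<close>,
  although \<open>- ln (1 - y / \<tau>)\<close> is unbounded there. For
  \<open>2 * D + 2 \<le> r * \<tau>\<close> this quantity enters the exponent with a nonpositive
  coefficient, so its lower bound \<open>y / \<tau>\<close> suffices. The lower bound on
  \<open>W\<close> is used locally and may degenerate as \<open>y\<close> approaches
  \<open>\<tau>\<close>.\<close>

lemma W_bounds:
  assumes y: "0 < y" "y < \<tau>"
  shows "exp (- ((D + 3) * y + R * y\<^sup>2) / (\<tau> - y)) * F y \<le> W \<tau> y"
    and "2 * D + 2 \<le> r * \<tau> \<Longrightarrow> W \<tau> y \<le> exp ((2 * D + 2) / \<tau> * y) * F y"
proof -
  \<comment> \<open>\<open>1 - y / \<tau> = e\<^sup>-\<^sup>\<sigma>\<close> with \<open>\<sigma> = l y\<close>, and the dilation factor \<open>\<tau> l\<close> lies in \<open>[1, e\<^sup>\<sigma>]\<close>.\<close>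
  define \<sigma> where "\<sigma> = - ln (1 - y / \<tau>)"
  define l where "l = \<sigma> / y"
  have \<tau>: "0 < \<tau>" and x: "0 < 1 - y / \<tau>" using y by auto
  have e: "exp (- \<sigma>) = 1 - y / \<tau>" using x by (simp add: \<sigma>_def)
  have \<sigma>1: "y / \<tau> \<le> \<sigma>" using ln_le_minus_one[OF x] by (simp add: \<sigma>_def)
  \<comment> \<open>The inequality \<open>ln z \<le> z - 1\<close>, now at the inverse of
    \<open>1 - y / \<tau>\<close>, bounds \<open>\<sigma>\<close> from above.\<close>
  have \<sigma>2: "\<sigma> \<le> y / (\<tau> - y)"
  proof -
    have "ln (inverse (1 - y / \<tau>)) \<le> inverse (1 - y / \<tau>) - 1" using x by (intro ln_le_minus_one) simp
    moreover have "inverse (1 - y / \<tau>) - 1 = y / (\<tau> - y)" using y by (simp add: field_simps)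
    ultimately show ?thesis unfolding \<sigma>_def ln_inverse by simp
  qed
  have \<sigma>0: "0 < \<sigma>" using \<sigma>1 y \<tau> by (meson divide_pos_pos less_le_trans)
  have ly: "l * y = \<sigma>" and l: "0 < l" using \<sigma>0 y by (auto simp: l_def)
  have lam1: "1 \<le> \<tau> * l" using \<sigma>1 y \<tau> by (simp add: l_def field_simps)
  have lam2: "\<tau> * l \<le> exp \<sigma>"
  proof -
    have "l \<le> 1 / (\<tau> - y)" using divide_right_mono[OF \<sigma>2, of y] y by (simp add: l_def)
    then have "\<tau> * l \<le> \<tau> / (\<tau> - y)" using mult_left_mono[of l "1 / (\<tau> - y)" \<tau>] \<tau> by simp
    also have "\<dots> = exp \<sigma>" using y e by (simp add: exp_minus field_simps)
    finally show ?thesis .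
  qed
  have Wy: "W \<tau> y = \<tau> powr (D - 1) * w \<tau> (exp (- (l * y)))"
    using y by (simp add: W_def reflected_def ly e)
  have ex1: "(- ((D + 2) * l) - R * (\<tau> * l - 1)) * y = - ((D + 2) * \<sigma>) - R * (\<tau> * \<sigma> - y)"
    and ex2: "((D + 2) * l - r * (\<tau> * l - 1)) * y = (D + 2) * \<sigma> - r * (\<tau> * \<sigma> - y)"
    unfolding ly[symmetric] by (simp_all add: algebra_simps)
  have D: "0 < D" by (rule D_pos)
  \<comment> \<open>Since \<open>D > 0\<close>, the exponent \<open>D - 1\<close> exceeds -1, so the
    power is at least \<open>1 / (\<tau> * l)\<close>, also when \<open>D < 1\<close>.\<close>
  have pw1: "exp (- \<sigma>) \<le> (\<tau> * l) powr (D - 1)"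
  proof -
    have "exp (- \<sigma>) \<le> inverse (\<tau> * l)"
      using lam1 lam2 unfolding exp_minus by (intro le_imp_inverse_le) auto
    also have "\<dots> = (\<tau> * l) powr (- 1)" using lam1 by (simp add: powr_minus)
    also have "\<dots> \<le> (\<tau> * l) powr (D - 1)" using lam1 D by (intro powr_mono) auto
    finally show ?thesis .
  qed
  have pw2: "(\<tau> * l) powr (D - 1) \<le> exp (D * \<sigma>)"
  proof -
    have "(\<tau> * l) powr (D - 1) \<le> (\<tau> * l) powr D" using lam1 by (intro powr_mono) auto
    also have "\<dots> \<le> exp \<sigma> powr D" using lam1 lam2 D by (intro powr_mono2) auto
    finally show ?thesis by (simp add: powr_def)
  qed
  show "exp (- ((D + 3) * y + R * y\<^sup>2) / (\<tau> - y)) * F y \<le> W \<tau> y"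
  proof -
    have R: "0 < R" using q r \<rho>[of 1] by simp
    have "\<tau> * \<sigma> - y \<le> y\<^sup>2 / (\<tau> - y)"
      using mult_left_mono[OF \<sigma>2, of \<tau>] \<tau> y by (simp add: field_simps power2_eq_square)
    \<comment> \<open>The coefficient \<open>D + 3\<close> is \<open>D + 2\<close> from the tilt
      plus 1 from \<open>pw1\<close>.\<close>
    then have "R * (\<tau> * \<sigma> - y) + (D + 3) * \<sigma> \<le> R * (y\<^sup>2 / (\<tau> - y)) + (D + 3) * (y / (\<tau> - y))"
      using \<sigma>2 R D by (intro add_mono mult_left_mono) auto
    also have "\<dots> = - (- ((D + 3) * y + R * y\<^sup>2) / (\<tau> - y))"
      unfolding minus_divide_left[symmetric] add_divide_distrib by simp
    finally have "- ((D + 3) * y + R * y\<^sup>2) / (\<tau> - y) \<le> - \<sigma> + (- ((D + 2) * l) - R * (\<tau> * l - 1)) * y"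
      unfolding ex1 by (simp add: algebra_simps)
    then have "exp (- ((D + 3) * y + R * y\<^sup>2) / (\<tau> - y))
        \<le> exp (- \<sigma>) * exp ((- ((D + 2) * l) - R * (\<tau> * l - 1)) * y)"
      by (simp only: exp_add[symmetric] exp_le_cancel_iff)
    also have "\<dots> \<le> (\<tau> * l) powr (D - 1) * exp ((- ((D + 2) * l) - R * (\<tau> * l - 1)) * y)"
      using pw1 by (intro mult_right_mono) auto
    finally show ?thesis
      unfolding Wy using w_scaled_bounds(1)[OF \<tau> l lam1, of y] F_nonneg[of y]
      by (meson mult_right_mono order_trans)
  qed
  show "W \<tau> y \<le> exp ((2 * D + 2) / \<tau> * y) * F y" if "2 * D + 2 \<le> r * \<tau>"
  proof -
    have "(r * \<tau> - (2 * D + 2)) * (y / \<tau>) \<le> (r * \<tau> - (2 * D + 2)) * \<sigma>"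
      using that \<sigma>1 by (intro mult_left_mono) auto
    moreover have "(r * \<tau> - (2 * D + 2)) * (y / \<tau>) = r * y - (2 * D + 2) / \<tau> * y"
      using \<tau> by (simp add: field_simps)
    ultimately have "D * \<sigma> + ((D + 2) * l - r * (\<tau> * l - 1)) * y \<le> (2 * D + 2) / \<tau> * y"
      unfolding ex2 by (simp add: algebra_simps)
    then have "exp (D * \<sigma>) * exp (((D + 2) * l - r * (\<tau> * l - 1)) * y) \<le> exp ((2 * D + 2) / \<tau> * y)"
      by (simp only: exp_add[symmetric] exp_le_cancel_iff)
    moreover have "(\<tau> * l) powr (D - 1) * exp (((D + 2) * l - r * (\<tau> * l - 1)) * y)
      \<le> exp (D * \<sigma>) * exp (((D + 2) * l - r * (\<tau> * l - 1)) * y)"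
      using pw2 by (intro mult_right_mono) auto
    ultimately show ?thesis
      unfolding Wy using w_scaled_bounds(2)[OF \<tau> l lam1, of y] F_nonneg[of y]
      by (meson mult_right_mono order_trans)
  qed
qed

section \<open>Locally uniform convergence\<close>

lemma F_locally_bounded:
  assumes "0 < x"
  obtains B where "0 \<le> B" "\<And>y. y \<in> {x / 2<..<2 * x} \<Longrightarrow> F y \<le> B"
proof -
  obtain C where C: "C \<ge> 0" "\<forall>y>0. F y \<le> C * (y powr (D - 1) * exp (- r * y))"
    using gamma_dominated_F by (auto simp: gamma_dominated_def)
  have "F y \<le> C * (((x / 2) powr (D - 1) + (2 * x) powr (D - 1)) * 1)" if y: "y \<in> {x / 2<..<2 * x}" for y
  proof -
    \<comment> \<open>The sign of \<open>D - 1\<close> decides whether the power increases or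
      decreases; the sum of the two endpoint values covers both cases.\<close>
    have "y powr (D - 1) \<le> (x / 2) powr (D - 1) + (2 * x) powr (D - 1)"
    proof (cases "D \<ge> 1")
      case True
      then have "y powr (D - 1) \<le> (2 * x) powr (D - 1)"
        using y assms by (intro powr_mono2) auto
      then show ?thesis by (simp add: add_increasing)
    next
      case False
      then have "y powr (D - 1) \<le> (x / 2) powr (D - 1)"
        using y assms by (intro powr_mono2') auto
      then show ?thesis by (simp add: add_increasing2)
    qed
    then have "C * (y powr (D - 1) * exp (- r * y)) \<le> C * (((x / 2) powr (D - 1) + (2 * x) powr (D - 1)) * 1)"
      using C(1) r y assms by (intro mult_left_mono mult_mono) auto
    moreover have "0 < y" using y assms by simp
    ultimately show ?thesis using C(2) by (meson order_trans)
  qed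
  moreover have "0 \<le> C * (((x / 2) powr (D - 1) + (2 * x) powr (D - 1)) * 1)" using C(1) by simp
  ultimately show ?thesis by (rule that[rotated])
qed

lemma W_locally_uniform_limit: "locally_uniform_limit {0<..} W F at_top"
  unfolding locally_uniform_limit_def
proof
  fix x :: real assume "x \<in> {0<..}"
  then have x: "0 < x" by simp
  obtain B where B: "0 \<le> B" "\<And>y. y \<in> {x / 2<..<2 * x} \<Longrightarrow> F y \<le> B"
    using F_locally_bounded[OF x] by blast
  define Y where "Y = 2 * x"
  \<comment> \<open>\<open>U\<close> and \<open>L\<close> are the factors of \<open>W_bounds\<close>
    at \<open>Y\<close>, the extreme ones for \<open>0 < y < Y\<close>; both tend to 1.\<close>
  define U where "U = (\<lambda>\<tau>. exp ((2 * D + 2) / \<tau> * Y))"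
  define L where "L = (\<lambda>\<tau>. exp (- ((D + 3) * Y + R * Y\<^sup>2) / (\<tau> - Y)))"
  have "filterlim (\<lambda>\<tau>. - Y + \<tau>) at_top at_top"
    by (rule filterlim_tendsto_add_at_top[OF tendsto_const filterlim_ident])
  then have at: "filterlim (\<lambda>\<tau>. \<tau> - Y) at_infinity at_top"
    by (intro filterlim_at_top_imp_at_infinity) simp
  have id: "filterlim (\<lambda>\<tau>::real. \<tau>) at_infinity at_top"
    by (intro filterlim_at_top_imp_at_infinity filterlim_ident)
  have "(U \<longlongrightarrow> exp (0 * Y)) at_top" "(L \<longlongrightarrow> exp 0) at_top"
    unfolding U_def L_def
    by (intro tendsto_exp tendsto_mult tendsto_const tendsto_divide_0[OF tendsto_const id])
      (intro tendsto_exp tendsto_divide_0[OF tendsto_const at])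
  then have "((\<lambda>\<tau>. B * ((U \<tau> - 1) + (1 - L \<tau>))) \<longlongrightarrow> B * ((exp (0 * Y) - 1) + (1 - exp 0))) at_top"
    by (intro tendsto_intros)
  then have E: "((\<lambda>\<tau>. B * ((U \<tau> - 1) + (1 - L \<tau>))) \<longlongrightarrow> 0) at_top" by simp
  have R: "0 < R" using q r \<rho>[of 1] by simp
  \<comment> \<open>The ball of radius \<open>x / 2\<close> stays away from 0 and lies in the
    interval on which \<open>B\<close> bounds \<open>F\<close>.\<close>
  have "uniform_limit ({0<..} \<inter> ball x (x / 2)) W F at_top"
  proof (rule uniform_limitI)
    fix e :: real assume "0 < e"
    have ev: "\<forall>\<^sub>F \<tau> in at_top. B * ((U \<tau> - 1) + (1 - L \<tau>)) < e"
      using order_tendstoD(2)[OF E \<open>0 < e\<close>] .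
    show "\<forall>\<^sub>F \<tau> in at_top. \<forall>y\<in>{0<..} \<inter> ball x (x / 2). dist (W \<tau> y) (F y) < e"
      using ev eventually_gt_at_top[of Y] eventually_ge_at_top[of "(2 * D + 2) / r"]
    proof eventually_elim
      case (elim \<tau>)
      then have \<tau>: "2 * D + 2 \<le> r * \<tau>" "Y < \<tau>" "0 < \<tau>"
        using r x by (auto simp: field_simps Y_def)
      show ?case
      proof
        fix y assume "y \<in> {0<..} \<inter> ball x (x / 2)"
        then have y: "0 < y" "y \<in> {x / 2<..<2 * x}" "y < Y"
          using x by (simp_all add: dist_real_def Y_def abs_if split: if_splits)
        then have yt: "y < \<tau>" using \<tau> by simp
        have "((D + 3) * y + R * y\<^sup>2) / (\<tau> - y) \<le> ((D + 3) * Y + R * Y\<^sup>2) / (\<tau> - Y)"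
          using y \<tau> R D_pos
          by (intro frac_le add_mono mult_left_mono power_mono) auto
        then have "L \<tau> \<le> exp (- ((D + 3) * y + R * y\<^sup>2) / (\<tau> - y))"
          unfolding L_def minus_divide_left[symmetric] by simp
        then have 1: "L \<tau> * F y \<le> W \<tau> y"
          using W_bounds(1)[OF y(1) yt] F_nonneg[of y] by (meson mult_right_mono order_trans)
        have "(2 * D + 2) / \<tau> * y \<le> (2 * D + 2) / \<tau> * Y"
          using y \<tau> D_pos by (intro mult_left_mono) auto
        then have "exp ((2 * D + 2) / \<tau> * y) \<le> U \<tau>" unfolding U_def by simp
        then have 2: "W \<tau> y \<le> U \<tau> * F y"
          using W_bounds(2)[OF y(1) yt \<tau>(1)] F_nonneg[of y] by (meson mult_right_mono order_trans)
        have UL: "0 \<le> U \<tau> - 1" "0 \<le> 1 - L \<tau>"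
        proof -
          have "0 < Y" using y by simp
          then have "0 \<le> (2 * D + 2) / \<tau> * Y" "0 \<le> ((D + 3) * Y + R * Y\<^sup>2) / (\<tau> - Y)"
            using \<tau> R D_pos
            by (auto intro!: mult_nonneg_nonneg divide_nonneg_nonneg add_nonneg_nonneg)
          then show "0 \<le> U \<tau> - 1" "0 \<le> 1 - L \<tau>"
            unfolding U_def L_def minus_divide_left[symmetric] by simp_all
        qed
        have 3: "F y * (U \<tau> - 1) \<le> B * (U \<tau> - 1)" "F y * (1 - L \<tau>) \<le> B * (1 - L \<tau>)"
          "0 \<le> F y * (U \<tau> - 1)" "0 \<le> F y * (1 - L \<tau>)"
          using mult_right_mono[OF B(2)[OF y(2)] UL(1)] mult_right_mono[OF B(2)[OF y(2)] UL(2)]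
            mult_nonneg_nonneg[OF F_nonneg UL(1)] mult_nonneg_nonneg[OF F_nonneg UL(2)] .
        have 4: "W \<tau> y - F y \<le> F y * (U \<tau> - 1)" using 2 by (simp add: algebra_simps)
        have 5: "F y - W \<tau> y \<le> F y * (1 - L \<tau>)" using 1 by (simp add: algebra_simps)
        have "\<bar>W \<tau> y - F y\<bar> \<le> B * ((U \<tau> - 1) + (1 - L \<tau>))"
          unfolding abs_le_iff distrib_left[of B] using 3 4 5 by linarith
        then show "dist (W \<tau> y) (F y) < e" using elim by (simp add: dist_real_def)
      qed
    qed
  qed
  then show "\<exists>\<epsilon>>0. uniform_limit ({0<..} \<inter> ball x \<epsilon>) W F at_top"
    using x by (intro exI[of _ "x / 2"]) auto
qed

lemma W_tendsto:
  assumes "0 < y"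
  shows "((\<lambda>\<tau>. W \<tau> y) \<longlongrightarrow> F y) at_top"
proof -
  from W_locally_uniform_limit assms obtain \<epsilon> where "\<epsilon> > 0" "uniform_limit ({0<..} \<inter> ball y \<epsilon>) W F at_top"
    unfolding locally_uniform_limit_def by auto
  then show ?thesis using assms by (intro tendsto_uniform_limitI) auto
qed

section \<open>Integrability, dominated convergence, weak limits and moments\<close>

lemma integrable_W:
  assumes "0 < \<tau>"
  shows "integrable lborel (W \<tau>)"
proof -
  \<comment> \<open>\<open>W_bounds\<close> gives an upper bound only for large
    \<open>\<tau>\<close>, whereas integrability is claimed for every \<open>\<tau> > 0\<close>. In
    the logarithmic variable the Jacobian \<open>exp (- s)\<close> cancels the 1 in the rate
    \<open>1 - \<tau> * r / 2\<close>, and decay remains.\<close>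
  obtain C where C: "C \<ge> 0"
    "\<forall>s>0. w \<tau> (exp (- s)) \<le> C * (s powr (D - 1) * exp ((1 - \<tau> * r / 2) * s))"
    using gamma_dominated_w_exp_minus[OF assms] by (auto simp: gamma_dominated_def)
  have "set_integrable lborel {0<..} (\<lambda>s. exp (- s) * w \<tau> (exp (- s)))"
  proof (rule set_integrable_bound)
    show "set_integrable lborel {0<..} (\<lambda>s. C * (s powr (D - 1) * exp (- (\<tau> * r / 2) * s)))"
      using D_pos r assms by (intro set_integrable_mult_right set_integrable_powr_exp) auto
    show "set_borel_measurable lborel {0<..} (\<lambda>s. exp (- s) * w \<tau> (exp (- s)))"
      unfolding set_borel_measurable_def by measurable
    have "norm (exp (- s) * w \<tau> (exp (- s))) \<le> norm (C * (s powr (D - 1) * exp (- (\<tau> * r / 2) * s)))"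
      if "s > 0" for s
    proof -
      have "exp (- s) * w \<tau> (exp (- s)) \<le> exp (- s) * (C * (s powr (D - 1) * exp ((1 - \<tau> * r / 2) * s)))"
        using C that by (intro mult_left_mono) auto
      also have "\<dots> = C * (s powr (D - 1) * (exp (- s) * exp ((1 - \<tau> * r / 2) * s)))" by simp
      also have "exp (- s) * exp ((1 - \<tau> * r / 2) * s) = exp (- (\<tau> * r / 2) * s)"
        by (simp add: exp_add[symmetric] algebra_simps)
      finally show ?thesis using C(1) w_nonneg[OF assms, of "exp (- s)"] by simp
    qed
    then show "AE s in lborel. s \<in> {0<..} \<longrightarrow>
        norm (exp (- s) * w \<tau> (exp (- s))) \<le> norm (C * (s powr (D - 1) * exp (- (\<tau> * r / 2) * s)))"
      by auto
  qed
  then have "integrable lborel (\<lambda>x. indicator {0<..<1} x *\<^sub>R w \<tau> x)"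
    by (subst (asm) set_integrable_exp_minus_subst) (auto simp: set_integrable_def)
  then have "integrable lborel (\<lambda>y. indicator {0<..<1} (1 + (- 1 / \<tau>) * y) *\<^sub>R w \<tau> (1 + (- 1 / \<tau>) * y))"
    using assms by (intro lborel_integrable_real_affine) auto
  then have "integrable lborel (\<lambda>y. \<tau> powr (D - 1) *
      (indicator {0<..<1} (1 + (- 1 / \<tau>) * y) *\<^sub>R w \<tau> (1 + (- 1 / \<tau>) * y)))"
    by (rule integrable_mult_right)
  also have "(\<lambda>y. \<tau> powr (D - 1) * (indicator {0<..<1} (1 + (- 1 / \<tau>) * y) *\<^sub>R w \<tau> (1 + (- 1 / \<tau>) * y))) = W \<tau>"
    using assms by (auto simp: W_def reflected_def indicator_def fun_eq_iff field_simps)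
  finally show ?thesis .
qed

lemma
  fixes \<phi> :: "real \<Rightarrow> real"
  assumes \<phi>: "\<phi> \<in> borel_measurable (restrict_space borel {0<..})"
    and bound: "\<And>y. 0 < y \<Longrightarrow> \<bar>\<phi> y\<bar> \<le> M * exp (\<delta> * y)" and \<delta>: "0 \<le> \<delta>" "\<delta> < r"
  shows set_integrable_F: "set_integrable lborel {0<..} (\<lambda>y. \<phi> y * F y)"
    and set_integrable_W: "0 < \<tau> \<Longrightarrow> set_integrable lborel {0<..} (\<lambda>y. \<phi> y * W \<tau> y)"
    and LBINT_W_tendsto: "((\<lambda>\<tau>. LBINT y:{0<..}. \<phi> y * W \<tau> y) \<longlongrightarrow> (LBINT y:{0<..}. \<phi> y * F y)) at_top"
proof -
  have m: "(\<lambda>y. indicator {0<..} y *\<^sub>R \<phi> y) \<in> borel_measurable borel"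
    using \<phi> by (subst (asm) borel_measurable_restrict_space_iff) auto
  have split: "indicator {0<..} y *\<^sub>R (\<phi> y * f y) = (indicator {0<..} y *\<^sub>R \<phi> y) * f y" for f and y :: real
    by simp
  have meas: "(\<lambda>y. indicator {0<..} y *\<^sub>R (\<phi> y * f y)) \<in> borel_measurable lborel"
    if [measurable]: "f \<in> borel_measurable borel" for f
    unfolding split using m by measurable
  have M: "0 \<le> M"
    using order_trans[OF abs_ge_zero bound[of 1]] by (simp add: zero_le_mult_iff)
  \<comment> \<open>Half of the gap \<open>r - \<delta>\<close> absorbs the factor
    \<open>exp ((2 * D + 2) / \<tau> * y)\<close> for large \<open>\<tau>\<close>; the other half
    keeps the majorant \<open>H\<close> integrable.\<close>
  define \<kappa> where "\<kappa> = (r - \<delta>) / 2"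
  have \<kappa>: "0 < \<kappa>" using \<delta> by (simp add: \<kappa>_def)
  obtain C where C: "C \<ge> 0" "\<forall>y>0. F y \<le> C * (y powr (D - 1) * exp (- r * y))"
    using gamma_dominated_F by (auto simp: gamma_dominated_def)
  define H where "H = (\<lambda>y. indicator {0<..} y *\<^sub>R ((M * C) * (y powr (D - 1) * exp (- \<kappa> * y))))"
  have H: "integrable lborel H"
    using set_integrable_mult_right[OF set_integrable_powr_exp[OF D_pos \<kappa>], of "M * C"]
    by (simp add: H_def set_integrable_def)
  \<comment> \<open>A generic value \<open>v\<close> makes this one estimate serve both
    \<open>F y\<close> and \<open>W \<tau> y\<close>.\<close>
  have dom: "norm (indicator {0<..} y *\<^sub>R (\<phi> y * v)) \<le> H y"
    if v: "0 \<le> v" "0 < y \<Longrightarrow> v \<le> exp (\<kappa> * y) * F y" for y v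
  proof (cases "0 < y")
    case True
    have "\<bar>\<phi> y\<bar> * v \<le> (M * exp (\<delta> * y)) * (exp (\<kappa> * y) * (C * (y powr (D - 1) * exp (- r * y))))"
    proof (intro mult_mono[OF bound[OF True]])
      show "v \<le> exp (\<kappa> * y) * (C * (y powr (D - 1) * exp (- r * y)))"
        using v(2)[OF True] C(2) True by (intro order_trans[OF v(2)[OF True]] mult_left_mono) auto
    qed (use v M in auto)
    also have "\<dots> = (M * C) * (y powr (D - 1) * (exp (\<delta> * y) * exp (\<kappa> * y) * exp (- r * y)))"
      by simp
    also have "exp (\<delta> * y) * exp (\<kappa> * y) * exp (- r * y) = exp (- \<kappa> * y)"
      unfolding exp_add[symmetric] \<kappa>_def by (simp add: field_simps)
    finally show ?thesis using True v by (simp add: H_def abs_mult)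
  qed (simp add: H_def)
  have F1: "F y \<le> exp (\<kappa> * y) * F y" if "0 < y" for y
    using that \<kappa> F_nonneg[of y] mult_right_mono[of 1 "exp (\<kappa> * y)" "F y"] by simp
  show F: "set_integrable lborel {0<..} (\<lambda>y. \<phi> y * F y)"
    unfolding set_integrable_def
  proof (rule Bochner_Integration.integrable_bound[OF H])
    show "AE y in lborel. norm (indicator {0<..} y *\<^sub>R (\<phi> y * F y)) \<le> norm (H y)"
      unfolding real_norm_def[of "H _"]
      by (intro AE_I2 order_trans[OF dom[OF F_nonneg F1] abs_ge_self])
  qed (rule meas[OF borel_measurable_F])
  show "set_integrable lborel {0<..} (\<lambda>y. \<phi> y * W \<tau> y)" if \<tau>: "0 < \<tau>"
    unfolding set_integrable_def
  proof (rule Bochner_Integration.integrable_bound)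
    \<comment> \<open>For fixed \<open>\<tau>\<close>, small or large, \<open>W\<close> is supported
      in \<open>0 < y < \<tau>\<close>, where \<open>\<phi>\<close> is bounded by a
      constant.\<close>
    show "integrable lborel (\<lambda>y. (M * exp (\<delta> * \<tau>)) * W \<tau> y)"
      by (intro integrable_mult_right integrable_W \<tau>)
    have "norm (indicator {0<..} y *\<^sub>R (\<phi> y * W \<tau> y)) \<le> norm ((M * exp (\<delta> * \<tau>)) * W \<tau> y)" for y
    proof (cases "0 < y \<and> y < \<tau>")
      case True
      have "\<delta> * y \<le> \<delta> * \<tau>" using True \<delta> by (intro mult_left_mono) auto
      then have "M * exp (\<delta> * y) \<le> M * exp (\<delta> * \<tau>)" using M by (intro mult_left_mono) auto
      with bound[of y] True have "\<bar>\<phi> y\<bar> \<le> M * exp (\<delta> * \<tau>)" by linarith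
      then show ?thesis using True M W_nonneg[OF \<tau>, of y]
        by (simp add: abs_mult mult_right_mono)
    qed (simp add: W_eq_0)
    then show "AE y in lborel. norm (indicator {0<..} y *\<^sub>R (\<phi> y * W \<tau> y)) \<le> norm ((M * exp (\<delta> * \<tau>)) * W \<tau> y)"
      by (intro AE_I2)
  qed (rule meas[OF borel_measurable_W])
  show "((\<lambda>\<tau>. LBINT y:{0<..}. \<phi> y * W \<tau> y) \<longlongrightarrow> (LBINT y:{0<..}. \<phi> y * F y)) at_top"
    unfolding set_lebesgue_integral_def
  proof (rule integral_dominated_convergence_at_top[OF _ _ H])
    show "AE y in lborel. ((\<lambda>\<tau>. indicator {0<..} y *\<^sub>R (\<phi> y * W \<tau> y)) \<longlongrightarrow> indicator {0<..} y *\<^sub>R (\<phi> y * F y)) at_top"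
    proof (intro AE_I2)
      fix y :: real
      show "((\<lambda>\<tau>. indicator {0<..} y *\<^sub>R (\<phi> y * W \<tau> y)) \<longlongrightarrow> indicator {0<..} y *\<^sub>R (\<phi> y * F y)) at_top"
        by (cases "0 < y") (auto intro!: tendsto_intros W_tendsto)
    qed
    show "\<forall>\<^sub>F \<tau> in at_top. AE y in lborel. norm (indicator {0<..} y *\<^sub>R (\<phi> y * W \<tau> y)) \<le> H y"
      using eventually_gt_at_top[of 0] eventually_ge_at_top[of "(2 * D + 2) / r"]
        eventually_ge_at_top[of "(2 * D + 2) / \<kappa>"]
    proof eventually_elim
      case (elim \<tau>)
      then have \<tau>: "2 * D + 2 \<le> r * \<tau>" "(2 * D + 2) / \<tau> \<le> \<kappa>"
        using r \<kappa> by (auto simp: field_simps)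
      have "W \<tau> y \<le> exp (\<kappa> * y) * F y" if "0 < y" for y
      proof (cases "y < \<tau>")
        case True
        have "exp ((2 * D + 2) / \<tau> * y) \<le> exp (\<kappa> * y)"
          unfolding exp_le_cancel_iff using \<tau>(2) that by (intro mult_right_mono) auto
        then show ?thesis
          using W_bounds(2)[OF that True \<tau>(1)] F_nonneg[of y] by (meson mult_right_mono order_trans)
      qed (simp add: W_eq_0 F_nonneg)
      then show ?case using dom[OF W_nonneg] elim by (intro AE_I2) auto
    qed
  qed (intro meas borel_measurable_F borel_measurable_W)+
qed

lemma set_integrable_W_iff:
  "set_integrable lborel {0<..<\<tau>} (\<lambda>y. \<phi> y * W \<tau> y) \<longleftrightarrow> set_integrable lborel {0<..} (\<lambda>y. \<phi> y * W \<tau> y)"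
  and LBINT_W_eq:
  "(LBINT y:{0<..<\<tau>}. \<phi> y * W \<tau> y) = (LBINT y:{0<..}. \<phi> y * W \<tau> y)"
proof -
  have "(\<lambda>y. indicator {0<..<\<tau>} y *\<^sub>R (\<phi> y * W \<tau> y)) = (\<lambda>y. indicator {0<..} y *\<^sub>R (\<phi> y * W \<tau> y))"
    by (auto simp: fun_eq_iff indicator_def W_eq_0)
  then show "set_integrable lborel {0<..<\<tau>} (\<lambda>y. \<phi> y * W \<tau> y) \<longleftrightarrow> set_integrable lborel {0<..} (\<lambda>y. \<phi> y * W \<tau> y)"
    "(LBINT y:{0<..<\<tau>}. \<phi> y * W \<tau> y) = (LBINT y:{0<..}. \<phi> y * W \<tau> y)"
    unfolding set_integrable_def set_lebesgue_integral_def by simp_all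
qed

lemma
  fixes P :: "real poly"
  shows set_integrable_poly_W: "0 < \<tau> \<Longrightarrow> set_integrable lborel {0<..<\<tau>} (\<lambda>y. poly P y * W \<tau> y)"
    and set_integrable_poly_F: "set_integrable lborel {0<..} (\<lambda>y. poly P y * F y)"
    and LBINT_poly_W_tendsto: "((\<lambda>\<tau>. LBINT y:{0<..<\<tau>}. poly P y * W \<tau> y)
      \<longlongrightarrow> (LBINT y:{0<..}. poly P y * F y)) at_top"
proof -
  obtain M where M: "\<forall>y>0. \<bar>poly P y\<bar> \<le> M * exp (r / 2 * y)"
    using poly_exp_bound[of "r / 2" P] r by auto
  have m: "poly P \<in> borel_measurable (restrict_space borel {0<..})"
    by (intro borel_measurable_continuous_on_restrict continuous_intros)
  have b: "0 \<le> r / 2" "r / 2 < r" using r by auto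
  show "0 < \<tau> \<Longrightarrow> set_integrable lborel {0<..<\<tau>} (\<lambda>y. poly P y * W \<tau> y)"
    unfolding set_integrable_W_iff using M by (intro set_integrable_W[OF m _ b]) auto
  show "set_integrable lborel {0<..} (\<lambda>y. poly P y * F y)"
    using M by (intro set_integrable_F[OF m _ b]) auto
  show "((\<lambda>\<tau>. LBINT y:{0<..<\<tau>}. poly P y * W \<tau> y) \<longlongrightarrow> (LBINT y:{0<..}. poly P y * F y)) at_top"
    unfolding LBINT_W_eq using M by (intro LBINT_W_tendsto[OF m _ b]) auto
qed

text \<open>The total mass is the moment of the constant polynomial 1.\<close>

lemma finite_measure_W: "0 < \<tau> \<Longrightarrow> finite_measure (density_on {0<..} (W \<tau>))"
  using set_integrable_poly_W[of \<tau> "[:1:]"] set_integrable_W_iff[of \<tau> "\<lambda>_. 1"]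
  by (intro finite_measure_density_on W_nonneg) auto

lemma finite_measure_F: "finite_measure (density_on {0<..} F)"
  using set_integrable_poly_F[of "[:1:]"]
  by (intro finite_measure_density_on F_nonneg) auto

text \<open>A bounded test function satisfies the growth bound with \<open>\<delta> = 0\<close>, and
  continuity supplies its measurability.\<close>

lemma W_weakly_converges:
  "weakly_converges_on {0<..} (\<lambda>\<tau>. density_on {0<..} (W \<tau>)) (density_on {0<..} F) at_top"
  unfolding weakly_converges_on_def
proof (intro allI impI)
  fix \<phi> :: "real \<Rightarrow> real"
  assume \<phi>: "continuous_on {0<..} \<phi> \<and> bounded (\<phi> ` {0<..})"
  then obtain M where M: "\<And>y. 0 < y \<Longrightarrow> \<bar>\<phi> y\<bar> \<le> M * exp (0 * y)"
    unfolding bounded_iff by auto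
  have m: "\<phi> \<in> borel_measurable (restrict_space borel {0<..})"
    using \<phi> by (intro borel_measurable_continuous_on_restrict) auto
  have "((\<lambda>\<tau>. LBINT y:{0<..}. \<phi> y * W \<tau> y) \<longlongrightarrow> (LBINT y:{0<..}. \<phi> y * F y)) at_top"
    using r by (intro LBINT_W_tendsto[OF m M]) auto
  moreover have "\<forall>\<^sub>F \<tau> in at_top. (LBINT y:{0<..}. \<phi> y * W \<tau> y) = (\<integral>y. \<phi> y \<partial>density_on {0<..} (W \<tau>))"
    using eventually_gt_at_top[of 0]
    by eventually_elim (intro integral_density_on[symmetric] m W_nonneg borel_measurable_W)
  ultimately show "((\<lambda>\<tau>. \<integral>y. \<phi> y \<partial>density_on {0<..} (W \<tau>)) \<longlongrightarrow> (\<integral>y. \<phi> y \<partial>density_on {0<..} F)) at_top"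
    by (simp add: integral_density_on[OF borel_measurable_F F_nonneg m] tendsto_cong)
qed

text \<open>The Jacobian \<open>1 / \<tau>\<close> of \<open>x = 1 - y / \<tau>\<close> turns
  \<open>\<tau> powr D\<close> into the factor \<open>\<tau> powr (D - 1)\<close> in
  \<open>W\<close>.\<close>

lemma density_on_W:
  assumes "0 < \<tau>"
  shows "density_on {0<..} (W \<tau>) = distr (density_on {0<..<1} (\<lambda>x. \<tau> powr D * w \<tau> x))
    (restrict_space borel {0<..}) (\<lambda>x. \<tau> * (1 - x))"
    (is "_ = distr ?M ?N ?T")
proof (rule measure_eqI)
  show "sets (density_on {0<..} (W \<tau>)) = sets (distr ?M ?N ?T)"
    by (simp add: sets_density_on)
  fix A assume "A \<in> sets (density_on {0<..} (W \<tau>))"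
  then have AN: "A \<in> sets ?N" and [measurable]: "A \<in> sets borel" and A: "A \<subseteq> {0<..}"
    by (auto simp: sets_density_on sets_restrict_space)
  have "?T \<in> borel_measurable (restrict_space borel {0<..<1})"
    by (intro measurable_restrict_space1) measurable
  then have "?T \<in> measurable (restrict_space borel {0<..<1}) ?N"
    using assms by (intro measurable_restrict_space2) (auto simp: space_restrict_space)
  also have "measurable (restrict_space borel {0<..<1}) ?N = measurable ?M ?N"
    by (intro measurable_cong_sets) (simp_all add: sets_density_on)
  finally have T: "?T \<in> measurable ?M ?N" .
  have B[measurable]: "?T -` A \<inter> {0<..<1} \<in> sets borel"
    using measurable_sets[OF T AN] by (auto simp: space_density_on sets_density_on sets_restrict_space)
  let ?f = "\<lambda>x. ennreal (\<tau> powr D * w \<tau> x) * indicator (?T -` A \<inter> {0<..<1}) x"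
  have "emeasure (distr ?M ?N ?T) A = emeasure ?M (?T -` A \<inter> {0<..<1})"
    using emeasure_distr[OF T AN] by (simp add: space_density_on)
  also have "\<dots> = (\<integral>\<^sup>+ x. ?f x \<partial>lborel)"
    by (intro emeasure_density_on B) auto
  also have "\<dots> = ennreal \<bar>- 1 / \<tau>\<bar> * (\<integral>\<^sup>+ y. ?f (1 + (- 1 / \<tau>) * y) \<partial>lborel)"
    using assms by (intro nn_integral_real_affine) auto
  also have "\<dots> = (\<integral>\<^sup>+ y. ennreal \<bar>- 1 / \<tau>\<bar> * ?f (1 + (- 1 / \<tau>) * y) \<partial>lborel)"
    by (intro nn_integral_cmult[symmetric]) measurable
  also have "\<dots> = (\<integral>\<^sup>+ y. ennreal (W \<tau> y) * indicator A y \<partial>lborel)"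
  proof (intro nn_integral_cong)
    fix y :: real
    have "\<tau> * (1 - (1 + (- 1 / \<tau>) * y)) = y" using assms by simp
    moreover have "1 + (- 1 / \<tau>) * y \<in> {0<..<1} \<longleftrightarrow> 0 < y \<and> y < \<tau>"
      using assms by (auto simp: field_simps)
    moreover have "1 / \<tau> * \<tau> powr D = \<tau> powr (D - 1)"
      using assms by (simp add: powr_diff)
    then have "ennreal \<bar>- 1 / \<tau>\<bar> * ennreal (\<tau> powr D * w \<tau> (1 - y / \<tau>))
        = ennreal (\<tau> powr (D - 1) * w \<tau> (1 - y / \<tau>))"
      using assms by (simp add: ennreal_mult'[symmetric] mult.assoc[symmetric])
    ultimately show "ennreal \<bar>- 1 / \<tau>\<bar> * ?f (1 + (- 1 / \<tau>) * y) = ennreal (W \<tau> y) * indicator A y"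
      by (auto simp: indicator_def W_def reflected_def)
  qed
  also have "\<dots> = emeasure (density_on {0<..} (W \<tau>)) A"
    using A by (intro emeasure_density_on[symmetric]) auto
  finally show "emeasure (density_on {0<..} (W \<tau>)) A = emeasure (distr ?M ?N ?T) A" ..
qed

end

section \<open>From a single row to all rows and to the mixed-type matrix\<close>

lemma ex_gamma_parameters:
  assumes "1 \<le> q" and "\<And>h. h \<in> {1..q} \<Longrightarrow> 0 < \<rho> h" and "\<And>h. h \<in> {1..q} \<Longrightarrow> 0 < d h"
  shows "\<exists>r R. gamma_parameters q \<rho> d r R"
proof -
  have "gamma_parameters q \<rho> d (Min (\<rho> ` {1..q})) (Max (\<rho> ` {1..q}))"
  proof
    show "0 < Min (\<rho> ` {1..q})" using assms by (subst Min_gr_iff) auto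
  qed (use assms in auto)
  then show ?thesis by blast
qed

theorem theorem4p1:
  fixes q p :: nat and d \<rho> \<xi> :: "nat \<Rightarrow> real" and D :: real
    and a b \<alpha> :: "real \<Rightarrow> nat \<Rightarrow> real"
    and w W :: "real \<Rightarrow> nat \<Rightarrow> real \<Rightarrow> real"
    and V :: "real \<Rightarrow> nat \<Rightarrow> nat \<Rightarrow> real \<Rightarrow> real"
    and F :: "nat \<Rightarrow> real \<Rightarrow> real"
  assumes "q \<ge> 1" and "p \<ge> 1"
    and "\<And>h. h \<in> {1..q} \<Longrightarrow> d h > 0"
    and "\<And>h. h \<in> {1..q} \<Longrightarrow> \<rho> h > 0"
    and "\<And>i h. i \<in> {1..p} \<Longrightarrow> h \<in> {1..q} \<Longrightarrow> \<xi> i + \<rho> h > 0"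
    and D_eq: "D = (\<Sum>h=1..q. d h)"
    and a_eq: "a = (\<lambda>\<tau> h. \<tau> * \<rho> h - 1)"
    and b_eq: "b = (\<lambda>\<tau> h. \<tau> * \<rho> h + d h - 1)"
    and \<alpha>_eq: "\<alpha> = (\<lambda>\<tau> i. \<tau> * \<xi> i)"
    and w_eq: "w = (\<lambda>\<tau> j. jacobi_weight q (a \<tau>) (b \<tau>) j)"
    and F_eq: "F = (\<lambda>j. gamma_row q \<rho> d j)"
    and W_eq: "W = (\<lambda>\<tau> j y. \<tau> powr (if j = 0 then D - 1 else D) * reflected \<tau> (w \<tau> j) y)"
    and V_eq: "V = (\<lambda>\<tau> j i y. \<tau> powr D * (1 - y / \<tau>) powr \<alpha> \<tau> i * reflected \<tau> (w \<tau> j) y)"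
  shows
    "(\<forall>j\<in>{0..q}.
        locally_uniform_limit {0<..} (\<lambda>\<tau>. W \<tau> j) (F j) at_top
        \<and> (\<forall>\<tau>>0. finite_measure (density_on {0<..} (W \<tau> j)))
        \<and> finite_measure (density_on {0<..} (F j))
        \<and> weakly_converges_on {0<..} (\<lambda>\<tau>. density_on {0<..} (W \<tau> j)) (density_on {0<..} (F j)) at_top
        \<and> (\<forall>P :: real poly.
              (\<forall>\<tau>>0. set_integrable lborel {0<..<\<tau>} (\<lambda>y. poly P y * W \<tau> j y))
              \<and> set_integrable lborel {0<..} (\<lambda>y. poly P y * F j y)
              \<and> ((\<lambda>\<tau>. LBINT y:{0<..<\<tau>}. poly P y * W \<tau> j y)
                    \<longlongrightarrow> (LBINT y:{0<..}. poly P y * F j y)) at_top))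
     \<and> (\<forall>j\<in>{1..q}. \<forall>i\<in>{1..p}.
        locally_uniform_limit {0<..} (\<lambda>\<tau>. V \<tau> j i) (\<lambda>y. exp (- \<xi> i * y) * F j y) at_top
        \<and> (\<forall>n::nat.
              (\<forall>\<tau>>0. set_integrable lborel {0<..<\<tau>} (\<lambda>y. y ^ n * V \<tau> j i y))
              \<and> set_integrable lborel {0<..} (\<lambda>y. y ^ n * exp (- \<xi> i * y) * F j y)
              \<and> ((\<lambda>\<tau>. LBINT y:{0<..<\<tau>}. y ^ n * V \<tau> j i y)
                    \<longlongrightarrow> (LBINT y:{0<..}. y ^ n * exp (- \<xi> i * y) * F j y)) at_top)
        \<and> (\<forall>\<tau>>0. density_on {0<..} (V \<tau> j i) =
              distr (density_on {0<..<1} (\<lambda>x. \<tau> powr (D + 1) * (w \<tau> j x * x powr \<alpha> \<tau> i)))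
                (restrict_space borel {0<..}) (\<lambda>x. \<tau> * (1 - x))))"
proof -
  \<comment> \<open>Raising one exponent turns row \<open>j\<close> into a row of the same form with
    exponents \<open>d' j\<close>, so a single locale covers all rows.\<close>
  define d' where "d' = (\<lambda>j. if j = 0 then d else d(j := d j + 1))"
  have d': "0 < d' j h" if "h \<in> {1..q}" for j h
    using that assms(3) by (auto simp: d'_def add_pos_pos)
  have sum_d': "(\<Sum>h=1..q. d' j h) = (if j = 0 then D else D + 1)" if "j \<in> {0..q}" for j
  proof (cases "j = 0")
    case False
    then have j: "j \<in> {1..q}" using that by simp
    have "(\<Sum>h=1..q. d' j h) = (\<Sum>h=1..q. d h + (if h = j then 1 else 0))"
      using False by (intro sum.cong) (auto simp: d'_def)
    then show ?thesis using j False by (simp add: sum.distrib D_eq)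
  qed (simp add: d'_def D_eq)
  have w: "w \<tau> j = iterated_conv mellin_conv q (\<lambda>h. beta_weight (\<tau> * \<rho> h - 1) (\<tau> * \<rho> h + d' j h - 1))" for \<tau> j
  proof -
    have "(if j = 0 then b \<tau> else (b \<tau>)(j := b \<tau> j + 1)) = (\<lambda>h. \<tau> * \<rho> h + d' j h - 1)"
      by (auto simp: d'_def b_eq fun_eq_iff)
    then show ?thesis by (simp add: w_eq jacobi_weight_def a_eq)
  qed
  have F: "F j = iterated_conv add_conv q (\<lambda>h. gamma_kernel (\<rho> h) (d' j h))" for j
    by (simp add: F_eq gamma_row_def d'_def)
  show ?thesis
  proof (intro conjI ballI)
    fix j assume j: "j \<in> {0..q}"
    obtain r R where "gamma_parameters q \<rho> (d' j) r R"
      using ex_gamma_parameters[of q \<rho> "d' j"] assms(1,4) d' by blast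
    then interpret P: gamma_parameters q \<rho> "d' j" r R .
    have W: "W \<tau> j = P.W \<tau>" for \<tau>
      using sum_d'[OF j] by (auto simp: W_eq P.W_def P.w_def w P.D_def fun_eq_iff)
    have F: "F j = P.F"
      by (simp add: F P.F_def)
    show "locally_uniform_limit {0<..} (\<lambda>\<tau>. W \<tau> j) (F j) at_top"
      unfolding W F by (rule P.W_locally_uniform_limit)
    show "\<forall>\<tau>>0. finite_measure (density_on {0<..} (W \<tau> j))"
      unfolding W by (intro allI impI P.finite_measure_W)
    show "finite_measure (density_on {0<..} (F j))"
      unfolding F by (rule P.finite_measure_F)
    show "weakly_converges_on {0<..} (\<lambda>\<tau>. density_on {0<..} (W \<tau> j)) (density_on {0<..} (F j)) at_top"
      unfolding W F by (rule P.W_weakly_converges)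
    show "\<forall>P :: real poly.
        (\<forall>\<tau>>0. set_integrable lborel {0<..<\<tau>} (\<lambda>y. poly P y * W \<tau> j y))
        \<and> set_integrable lborel {0<..} (\<lambda>y. poly P y * F j y)
        \<and> ((\<lambda>\<tau>. LBINT y:{0<..<\<tau>}. poly P y * W \<tau> j y)
              \<longlongrightarrow> (LBINT y:{0<..}. poly P y * F j y)) at_top"
      unfolding W F
      by (intro allI conjI impI P.set_integrable_poly_W P.set_integrable_poly_F P.LBINT_poly_W_tendsto)
  next
    fix j i assume j: "j \<in> {1..q}" and i: "i \<in> {1..p}"
    \<comment> \<open>The hypothesis \<open>\<xi> i + \<rho> h > 0\<close> is the positivity of the
      shifted rates, so a matrix entry is again a single row of the locale.\<close>
    obtain r R where "gamma_parameters q (\<lambda>h. \<rho> h + \<xi> i) (d' j) r R"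
      using ex_gamma_parameters[of q "\<lambda>h. \<rho> h + \<xi> i" "d' j"] assms(1) assms(5)[OF i] d'
      by (auto simp: add.commute)
    then interpret P: gamma_parameters q "\<lambda>h. \<rho> h + \<xi> i" "d' j" r R .
    \<comment> \<open>As \<open>j \<ge> 1\<close>, the exponent sum of this row is
      \<open>D + 1\<close>, and its factor \<open>\<tau> powr (P.D - 1)\<close> is the
      \<open>\<tau> powr D\<close> of \<open>V\<close>.\<close>
    have D: "P.D = D + 1" using sum_d'[of j] j by (simp add: P.D_def)
    have Pw: "x powr \<alpha> \<tau> i * w \<tau> j x = P.w \<tau> x" if "0 < x" for \<tau> x
      using iterated_beta_weight_shift[OF assms(1) that] by (simp add: \<alpha>_eq w P.w_def)
    have V: "V \<tau> j i = P.W \<tau>" for \<tau>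
    proof
      fix y
      \<comment> \<open>Both sides vanish unless \<open>0 < y\<close> and \<open>y < \<tau>\<close>;
        then \<open>1 - y / \<tau>\<close> is positive and \<open>Pw\<close> applies.\<close>
      show "V \<tau> j i y = P.W \<tau> y"
        using Pw[of "1 - y / \<tau>" \<tau>] by (auto simp: V_eq P.W_def D reflected_def)
    qed
    have F: "exp (- \<xi> i * y) * F j y = P.F y" for y
      using iterated_gamma_kernel_shift[OF assms(1)] by (simp add: F P.F_def)
    show "locally_uniform_limit {0<..} (\<lambda>\<tau>. V \<tau> j i) (\<lambda>y. exp (- \<xi> i * y) * F j y) at_top"
      unfolding V F by (rule P.W_locally_uniform_limit)
    show "\<forall>n::nat.
        (\<forall>\<tau>>0. set_integrable lborel {0<..<\<tau>} (\<lambda>y. y ^ n * V \<tau> j i y))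
        \<and> set_integrable lborel {0<..} (\<lambda>y. y ^ n * exp (- \<xi> i * y) * F j y)
        \<and> ((\<lambda>\<tau>. LBINT y:{0<..<\<tau>}. y ^ n * V \<tau> j i y)
              \<longlongrightarrow> (LBINT y:{0<..}. y ^ n * exp (- \<xi> i * y) * F j y)) at_top"
    proof
      fix n :: nat
      have p: "y ^ n = poly (monom 1 n) y" for y :: real by (simp add: poly_monom)
      show "(\<forall>\<tau>>0. set_integrable lborel {0<..<\<tau>} (\<lambda>y. y ^ n * V \<tau> j i y))
        \<and> set_integrable lborel {0<..} (\<lambda>y. y ^ n * exp (- \<xi> i * y) * F j y)
        \<and> ((\<lambda>\<tau>. LBINT y:{0<..<\<tau>}. y ^ n * V \<tau> j i y)
              \<longlongrightarrow> (LBINT y:{0<..}. y ^ n * exp (- \<xi> i * y) * F j y)) at_top"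
        unfolding mult.assoc V F p
        by (intro allI conjI impI P.set_integrable_poly_W P.set_integrable_poly_F P.LBINT_poly_W_tendsto)
    qed
    show "\<forall>\<tau>>0. density_on {0<..} (V \<tau> j i) =
        distr (density_on {0<..<1} (\<lambda>x. \<tau> powr (D + 1) * (w \<tau> j x * x powr \<alpha> \<tau> i)))
          (restrict_space borel {0<..}) (\<lambda>x. \<tau> * (1 - x))"
    proof (intro allI impI)
      fix \<tau> :: real assume "0 < \<tau>"
      have "density_on {0<..<1} (\<lambda>x. \<tau> powr (D + 1) * (w \<tau> j x * x powr \<alpha> \<tau> i))
        = density_on {0<..<1} (\<lambda>x. \<tau> powr P.D * P.w \<tau> x)"
        by (intro density_on_cong) (simp add: D Pw[symmetric] mult.commute)
      then show "density_on {0<..} (V \<tau> j i) =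
        distr (density_on {0<..<1} (\<lambda>x. \<tau> powr (D + 1) * (w \<tau> j x * x powr \<alpha> \<tau> i)))
          (restrict_space borel {0<..}) (\<lambda>x. \<tau> * (1 - x))"
        unfolding V by (simp only: P.density_on_W[OF \<open>0 < \<tau>\<close>])
    qed
  qed
qed

end
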